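(* Let $A$ and $B$ be $C^*$-algebras and let $V$ be a Hilbert $A$-$B$-bimodule. Put $$\widetilde{QM}(V)=\{t\in V^{**} : atb\in V \text{ for all } a\in A,\ b\in B\},$$ a linear subspace of the Banach bidual $V^{**}$ of $V$. For $t\in\widetilde{QM}(V)$ let $q_t\colon A\times B\to V$ be given by $q_t(a,b)=atb$. Then the map $$\varphi\colon \widetilde{QM}(V)\to QM(V),\qquad t\mapsto q_t,$$ is a well-defined linear isometry of $\widetilde{QM}(V)$ (with the norm of $V^{**}$) onto $QM(V)$.
   Context: A Hilbert $A$-$B$-bimodule $V$ is both a left Hilbert $A$-module, with $A$-valued inner product ${}_A\langle\cdot,\cdot\rangle$, and a right Hilbert $B$-module, with $B$-valued inner product $\langle\cdot,\cdot\rangle_B$, with commuting actions and such that ${}_A\langle x,y\rangle z=x\langle y,z\rangle_B$ for all $x,y,z\in V$. (The inner products are not assumed full. The two norms on $V$ coming from the two inner products coincide.) The space of quasi-multipliers $QM(V)=\mathrm{Hom}_{A,B}(A\times B,V)$ is the set of bounded bilinear maps $q\colon A\times B\to V$ with $q(ca,bd)=c\,q(a,b)\,d$ for $a,c\in A$, $b,d\in B$, with norm $\|q\|=\sup\{\|q(a,b)\| : a\in A, b\in B, \|a\|\le1,\|b\|\le 1\}$. $V$ is regarded as a subspace of $V^{**}$ via the canonical embedding, and $V^{**}$ carries the canonical $A$-$B$-bimodule structure extending that of $V$: $(atb)(f)=t(f(a\,\cdot\,b))$ for $t\in V^{**}$, $f\in V^*$, $a\in A$, $b\in B$, where $f(a\,\cdot\,b)\in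 V^*$ is $x\mapsto f(axb)$. *)

theory Defs
  imports "HOL-Analysis.Analysis"
begin

section \<open>Complex normed spaces and C*-algebras\<close>

class complex_vector = real_vector +
  fixes scaleC :: "complex \<Rightarrow> 'a \<Rightarrow> 'a"  (infixr \<open>*\<^sub>C\<close> 75)
  assumes scaleC_add_right: "c *\<^sub>C (x + y) = c *\<^sub>C x + c *\<^sub>C y"
    and scaleC_add_left: "(c + d) *\<^sub>C x = c *\<^sub>C x + d *\<^sub>C x"
    and scaleC_scaleC: "c *\<^sub>C d *\<^sub>C x = (c * d) *\<^sub>C x"
    and scaleC_one: "1 *\<^sub>C x = x"
    and scaleR_scaleC: "r *\<^sub>R x = complex_of_real r *\<^sub>C x"

class complex_normed_vector = real_normed_vector + complex_vector +
  assumes norm_scaleC: "norm (c *\<^sub>C x) = cmod c * norm x"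

global_interpretation complex_vector:
  vector_space "scaleC :: complex \<Rightarrow> 'a \<Rightarrow> 'a::complex_vector"
  defines csubspace = complex_vector.subspace
  by unfold_locales
    (simp_all add: scaleC_add_right scaleC_add_left scaleC_scaleC scaleC_one)

abbreviation clinear :: "('a::complex_vector \<Rightarrow> 'b::complex_vector) \<Rightarrow> bool"
  where "clinear \<equiv> Vector_Spaces.linear scaleC scaleC"

lemma clinearI:
  assumes "\<And>x y. f (x + y) = f x + f y" "\<And>c x. f (c *\<^sub>C x) = c *\<^sub>C f x"
  shows "clinear f"
  by unfold_locales (simp_all add: assms)

lemma clinear_add: "clinear f \<Longrightarrow> f (x + y) = f x + f y"
  by (simp add: Vector_Spaces.linear_iff)

lemma clinear_scaleC: "clinear f \<Longrightarrow> f (c *\<^sub>C x) = c *\<^sub>C f x"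
  by (simp add: Vector_Spaces.linear_iff)

definition cbilinear ::
    "('a::complex_vector \<Rightarrow> 'b::complex_vector \<Rightarrow> 'c::complex_vector) \<Rightarrow> bool"
  where "cbilinear f \<longleftrightarrow> (\<forall>x. clinear (f x)) \<and> (\<forall>y. clinear (\<lambda>x. f x y))"

instantiation complex :: complex_normed_vector
begin

definition scaleC_complex :: "complex \<Rightarrow> complex \<Rightarrow> complex"
  where "scaleC_complex c z = c * z"

instance
  by standard
    (simp_all add: scaleC_complex_def algebra_simps scaleR_conv_of_real norm_mult)

end

text \<open>C*-algebras are complex and need not have a unit.\<close>

class cstar_algebra = complex_normed_vector + real_normed_algebra + banach +
  fixes star :: "'a \<Rightarrow> 'a"
  assumes scaleC_mult_left: "(c *\<^sub>C x) * y = c *\<^sub>C (x * y)"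
    and scaleC_mult_right: "x * (c *\<^sub>C y) = c *\<^sub>C (x * y)"
    and star_add: "star (x + y) = star x + star y"
    and star_scaleC: "star (c *\<^sub>C x) = cnj c *\<^sub>C star x"
    and star_mult: "star (x * y) = star y * star x"
    and star_star: "star (star x) = x"
    and norm_star_mult: "norm (star x * x) = (norm x)\<^sup>2"

definition cstar_positive :: "'a::cstar_algebra \<Rightarrow> bool"
  where "cstar_positive a \<longleftrightarrow> (\<exists>b. a = star b * b)"

lemma norm_star: "norm (star x) = norm (x::'a::cstar_algebra)"
proof -
  have *: "norm y \<le> norm (star y)" for y :: 'a
  proof (cases "norm y = 0")
    case False
    have "norm y * norm y \<le> norm (star y) * norm y"
      using norm_mult_ineq[of "star y" y] norm_star_mult[of y]
      by (simp add: power2_eq_square)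
    then show ?thesis
      using False by simp
  qed simp
  show ?thesis
    using *[of x] *[of "star x"] by (simp add: star_star)
qed


section \<open>The Banach dual\<close>

typedef (overloaded) 'a cdual =
    "{f :: 'a::complex_normed_vector \<Rightarrow> complex. bounded_linear f \<and> clinear f}"
  morphisms cdual_apply CDual
proof -
  have "(\<lambda>x. 0) \<in> {f :: 'a \<Rightarrow> complex. bounded_linear f \<and> clinear f}"
    by (auto intro!: clinearI simp: scaleC_complex_def)
  then show ?thesis
    by blast
qed

setup_lifting type_definition_cdual

lemma cdual_eqI: "(\<And>x. cdual_apply f x = cdual_apply g x) \<Longrightarrow> f = g"
  by (simp add: cdual_apply_inject[symmetric] fun_eq_iff)

lemma bounded_linear_cdual_apply: "bounded_linear (cdual_apply f)"
  using cdual_apply[of f] by simp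

lemma clinear_cdual_apply: "clinear (cdual_apply f)"
  using cdual_apply[of f] by simp

lemmas cdual_apply_add = clinear_add[OF clinear_cdual_apply]
lemmas cdual_apply_scaleC = clinear_scaleC[OF clinear_cdual_apply]

lemma CDual_inverse':
  assumes "\<And>x y. f (x + y) = f x + f y" "\<And>c x. f (c *\<^sub>C x) = c * f x"
    "\<And>x. cmod (f x) \<le> K * norm x"
  shows "cdual_apply (CDual f) = f"
proof -
  have "bounded_linear f"
    using assms(1) assms(3)
    by (intro bounded_linear_intro[where K = K])
      (simp_all add: scaleR_scaleC[where 'a = 'a] assms(2) scaleR_conv_of_real mult.commute)
  moreover have "clinear f"
    by (intro clinearI) (simp_all add: assms scaleC_complex_def)
  ultimately show ?thesis
    by (simp add: CDual_inverse)
qed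

instantiation cdual :: (complex_normed_vector) complex_normed_vector
begin

lift_definition zero_cdual :: "'a cdual" is "\<lambda>x. 0"
  by (auto intro!: clinearI simp: scaleC_complex_def)

lift_definition plus_cdual :: "'a cdual \<Rightarrow> 'a cdual \<Rightarrow> 'a cdual"
  is "\<lambda>f g x. f x + g x"
  by (auto intro!: clinearI bounded_linear_add
      simp: clinear_add clinear_scaleC scaleC_add_right)

lift_definition uminus_cdual :: "'a cdual \<Rightarrow> 'a cdual" is "\<lambda>f x. - f x"
  by (auto intro!: clinearI bounded_linear_minus
      simp: clinear_add clinear_scaleC scaleC_complex_def)

lift_definition minus_cdual :: "'a cdual \<Rightarrow> 'a cdual \<Rightarrow> 'a cdual"
  is "\<lambda>f g x. f x - g x"
  by (auto intro!: clinearI bounded_linear_sub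
      simp: clinear_add clinear_scaleC scaleC_complex_def algebra_simps)

lift_definition scaleC_cdual :: "complex \<Rightarrow> 'a cdual \<Rightarrow> 'a cdual"
  is "\<lambda>c f x. c * f x"
  by (auto intro!: clinearI bounded_linear_const_mult
      simp: clinear_add clinear_scaleC scaleC_complex_def algebra_simps)

definition scaleR_cdual :: "real \<Rightarrow> 'a cdual \<Rightarrow> 'a cdual"
  where "scaleR_cdual r f = complex_of_real r *\<^sub>C f"

definition norm_cdual :: "'a cdual \<Rightarrow> real"
  where "norm_cdual f = onorm (cdual_apply f)"

definition dist_cdual :: "'a cdual \<Rightarrow> 'a cdual \<Rightarrow> real"
  where "dist_cdual f g = norm (f - g)"

definition [code del]:
  "(uniformity :: ('a cdual \<times> 'a cdual) filter) =
    (INF e\<in>{0 <..}. principal {(x, y). dist x y < e})"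

definition open_cdual :: "'a cdual set \<Rightarrow> bool"
  where [code del]: "open_cdual S =
    (\<forall>x\<in>S. \<forall>\<^sub>F (x', y) in uniformity. x' = x \<longrightarrow> y \<in> S)"

definition sgn_cdual :: "'a cdual \<Rightarrow> 'a cdual"
  where "sgn_cdual f = inverse (norm f) *\<^sub>R f"

instance
proof
  fix f g h :: "'a cdual" and c d :: complex and r s :: real
  show "f + g + h = f + (g + h)" "f + g = g + f" "0 + f = f" "- f + f = 0" "f - g = f + - g"
    by (transfer; simp add: fun_eq_iff)+
  have C: "c *\<^sub>C (f + g) = c *\<^sub>C f + c *\<^sub>C g" "(c + d) *\<^sub>C f = c *\<^sub>C f + d *\<^sub>C f"
      "c *\<^sub>C d *\<^sub>C f = (c * d) *\<^sub>C f" "1 *\<^sub>C f = f" for c d and f g :: "'a cdual"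
    by (transfer; simp add: fun_eq_iff algebra_simps)+
  show "c *\<^sub>C (f + g) = c *\<^sub>C f + c *\<^sub>C g" "(c + d) *\<^sub>C f = c *\<^sub>C f + d *\<^sub>C f"
      "c *\<^sub>C d *\<^sub>C f = (c * d) *\<^sub>C f" "1 *\<^sub>C f = f"
    by (fact C)+
  show "r *\<^sub>R f = complex_of_real r *\<^sub>C f"
    by (simp add: scaleR_cdual_def)
  show "r *\<^sub>R (f + g) = r *\<^sub>R f + r *\<^sub>R g" "(r + s) *\<^sub>R f = r *\<^sub>R f + s *\<^sub>R f"
      "r *\<^sub>R s *\<^sub>R f = (r * s) *\<^sub>R f" "1 *\<^sub>R f = f"
    by (simp_all add: scaleR_cdual_def C)
  show "dist f g = norm (f - g)" "sgn f = inverse (norm f) *\<^sub>R f"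
    by (fact dist_cdual_def sgn_cdual_def)+
  show "(uniformity :: ('a cdual \<times> 'a cdual) filter) =
      (INF e\<in>{0 <..}. principal {(x, y). dist x y < e})"
    by (fact uniformity_cdual_def)
  show "open S = (\<forall>x\<in>S. \<forall>\<^sub>F (x', y) in uniformity. x' = x \<longrightarrow> y \<in> S)"
    for S :: "'a cdual set"
    by (fact open_cdual_def)
  show "norm f = 0 \<longleftrightarrow> f = 0"
    by (simp add: norm_cdual_def onorm_eq_0[OF bounded_linear_cdual_apply])
      (transfer, simp add: fun_eq_iff)
  show "norm (f + g) \<le> norm f + norm g"
    using onorm_triangle[OF bounded_linear_cdual_apply[of f] bounded_linear_cdual_apply[of g]]
    by (simp add: norm_cdual_def plus_cdual.rep_eq)
  have N: "norm (c *\<^sub>C f) = cmod c * norm f" for c and f :: "'a cdual"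
  proof -
    have le: "norm (c *\<^sub>C f) \<le> cmod c * norm f" for c and f :: "'a cdual"
      unfolding norm_cdual_def
    proof (rule onorm_bound)
      fix x
      show "cmod (cdual_apply (c *\<^sub>C f) x) \<le> cmod c * onorm (cdual_apply f) * norm x"
        using onorm[OF bounded_linear_cdual_apply[of f], of x]
        by (simp add: scaleC_cdual.rep_eq norm_mult mult.assoc mult_left_mono)
    qed (simp add: onorm_pos_le[OF bounded_linear_cdual_apply])
    show ?thesis
    proof (cases "c = 0")
      case True
      have "norm (0 *\<^sub>C f) = 0"
        using le[of 0 f] onorm_pos_le[OF bounded_linear_cdual_apply[of "0 *\<^sub>C f"]]
        by (simp add: norm_cdual_def)
      then show ?thesis
        using True by simp
    next
      case False
      have "cmod c * norm f = cmod c * norm (inverse c *\<^sub>C c *\<^sub>C f)"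
        using False by (simp add: C)
      also have "\<dots> \<le> cmod c * (cmod (inverse c) * norm (c *\<^sub>C f))"
        by (intro mult_left_mono le) simp
      also have "\<dots> = norm (c *\<^sub>C f)"
        using False by (simp add: norm_inverse)
      finally show ?thesis
        using le[of c f] by simp
    qed
  qed
  show "norm (c *\<^sub>C f) = cmod c * norm f"
    by (fact N)
  show "norm (r *\<^sub>R f) = \<bar>r\<bar> * norm f"
    by (simp add: scaleR_cdual_def N)
qed

end

lemma norm_cdual_apply_le: "cmod (cdual_apply f x) \<le> norm f * norm x"
  using onorm[OF bounded_linear_cdual_apply] by (simp add: norm_cdual_def)

lemma norm_cdual_bound: "0 \<le> K \<Longrightarrow> (\<And>x. cmod (cdual_apply f x) \<le> K * norm x) \<Longrightarrow> norm f \<le> K"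
  by (simp add: norm_cdual_def onorm_bound)

definition bidual_embed :: "'v::complex_normed_vector \<Rightarrow> 'v cdual cdual"
  where "bidual_embed x = CDual (\<lambda>f. cdual_apply f x)"

lemma bidual_embed_apply: "cdual_apply (bidual_embed x) f = cdual_apply f x"
  unfolding bidual_embed_def
  by (subst CDual_inverse'[where K = "norm x"])
    (simp_all add: plus_cdual.rep_eq scaleC_cdual.rep_eq
      norm_cdual_apply_le[THEN order_trans] mult.commute)


section \<open>Hilbert modules and bimodules\<close>

locale left_hilbert_module =
  fixes lact :: "'a::cstar_algebra \<Rightarrow> 'v::{complex_normed_vector, banach} \<Rightarrow> 'v"
    and lip :: "'v \<Rightarrow> 'v \<Rightarrow> 'a"
  assumes cbilinear_lact: "cbilinear lact"
    and lact_lact: "lact a (lact a' x) = lact (a * a') x"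
    and clinear_lip: "clinear (\<lambda>x. lip x y)"
    and lip_lact: "lip (lact a x) y = a * lip x y"
    and star_lip: "star (lip x y) = lip y x"
    and lip_positive: "cstar_positive (lip x x)"
    and norm_lip: "norm x = sqrt (norm (lip x x))"

locale right_hilbert_module =
  fixes ract :: "'v::{complex_normed_vector, banach} \<Rightarrow> 'b::cstar_algebra \<Rightarrow> 'v"
    and rip :: "'v \<Rightarrow> 'v \<Rightarrow> 'b"
  assumes cbilinear_ract: "cbilinear ract"
    and ract_ract: "ract (ract x b) b' = ract x (b * b')"
    and clinear_rip: "clinear (rip x)"
    and rip_ract: "rip x (ract y b) = rip x y * b"
    and star_rip: "star (rip x y) = rip y x"
    and rip_positive: "cstar_positive (rip x x)"
    and norm_rip: "norm x = sqrt (norm (rip x x))"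

locale hilbert_bimodule =
  left_hilbert_module lact lip + right_hilbert_module ract rip
  for lact :: "'a::cstar_algebra \<Rightarrow> 'v::{complex_normed_vector, banach} \<Rightarrow> 'v"
    and ract :: "'v \<Rightarrow> 'b::cstar_algebra \<Rightarrow> 'v"
    and lip :: "'v \<Rightarrow> 'v \<Rightarrow> 'a"
    and rip :: "'v \<Rightarrow> 'v \<Rightarrow> 'b" +
  assumes ract_lact: "ract (lact a x) b = lact a (ract x b)"
    and lip_rip: "lact (lip x y) z = ract x (rip y z)"


section \<open>Quasi-multipliers\<close>

definition quasi_multipliers ::
    "('a::cstar_algebra \<Rightarrow> 'v::complex_normed_vector \<Rightarrow> 'v) \<Rightarrow> ('v \<Rightarrow> 'b::cstar_algebra \<Rightarrow> 'v)
      \<Rightarrow> ('a \<Rightarrow> 'b \<Rightarrow> 'v) set"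
  where "quasi_multipliers lact ract =
    {q. bounded_bilinear q \<and> cbilinear q \<and>
        (\<forall>c a b d. q (c * a) (b * d) = ract (lact c (q a b)) d)}"

definition qm_norm ::
    "('a::cstar_algebra \<Rightarrow> 'b::cstar_algebra \<Rightarrow> 'v::complex_normed_vector) \<Rightarrow> real"
  where "qm_norm q = Sup {norm (q a b) | a b. norm a \<le> 1 \<and> norm b \<le> 1}"

definition dual_act ::
    "('a::cstar_algebra \<Rightarrow> 'v::complex_normed_vector \<Rightarrow> 'v) \<Rightarrow> ('v \<Rightarrow> 'b::cstar_algebra \<Rightarrow> 'v)
      \<Rightarrow> 'a \<Rightarrow> 'b \<Rightarrow> 'v cdual \<Rightarrow> 'v cdual"
  where "dual_act lact ract a b f = CDual (\<lambda>x. cdual_apply f (ract (lact a x) b))"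

definition bidual_act ::
    "('a::cstar_algebra \<Rightarrow> 'v::complex_normed_vector \<Rightarrow> 'v) \<Rightarrow> ('v \<Rightarrow> 'b::cstar_algebra \<Rightarrow> 'v)
      \<Rightarrow> 'a \<Rightarrow> 'v cdual cdual \<Rightarrow> 'b \<Rightarrow> 'v cdual cdual"
  where "bidual_act lact ract a t b = CDual (\<lambda>f. cdual_apply t (dual_act lact ract a b f))"

definition bidual_quasi_multipliers ::
    "('a::cstar_algebra \<Rightarrow> 'v::complex_normed_vector \<Rightarrow> 'v) \<Rightarrow> ('v \<Rightarrow> 'b::cstar_algebra \<Rightarrow> 'v)
      \<Rightarrow> 'v cdual cdual set"
  where "bidual_quasi_multipliers lact ract =
    {t. \<forall>a b. bidual_act lact ract a t b \<in> range bidual_embed}"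

definition quasi_multiplier_of ::
    "('a::cstar_algebra \<Rightarrow> 'v::complex_normed_vector \<Rightarrow> 'v) \<Rightarrow> ('v \<Rightarrow> 'b::cstar_algebra \<Rightarrow> 'v)
      \<Rightarrow> 'v cdual cdual \<Rightarrow> 'a \<Rightarrow> 'b \<Rightarrow> 'v"
  where "quasi_multiplier_of lact ract t a b =
    (THE x. bidual_embed x = bidual_act lact ract a t b)"

text \<open>Since \<open>CDual\<close> is unspecified outside the bounded functionals, the next lemmas record that
  the two actions have the intended values on Hilbert bimodules.\<close>

context left_hilbert_module
begin

lemma norm_lact_le: "norm (lact a x) \<le> norm a * norm x"
proof -
  have "lip (lact a x) (lact a x) = a * (lip x x * star a)"
    by (metis lip_lact star_lip star_mult)
  then have "(norm (lact a x))\<^sup>2 = norm (a * (lip x x * star a))"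
    by (simp add: norm_lip[of "lact a x"])
  also have "\<dots> \<le> norm a * (norm (lip x x) * norm a)"
    using norm_mult_ineq[of "lip x x" "star a"]
    by (intro order_trans[OF norm_mult_ineq] mult_left_mono) (simp_all add: norm_star)
  also have "\<dots> = (norm a * norm x)\<^sup>2"
    by (simp add: norm_lip[of x] power_mult_distrib power2_eq_square)
  finally show ?thesis
    by (rule power2_le_imp_le) simp
qed

end

context right_hilbert_module
begin

lemma norm_ract_le: "norm (ract x b) \<le> norm x * norm b"
proof -
  have "rip (ract x b) (ract x b) = star b * rip x x * b"
    by (metis rip_ract star_rip star_mult)
  then have "(norm (ract x b))\<^sup>2 = norm (star b * rip x x * b)"
    by (simp add: norm_rip[of "ract x b"])
  also have "\<dots> \<le> norm b * norm (rip x x) * norm b"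
    using norm_mult_ineq[of "star b" "rip x x"]
    by (intro order_trans[OF norm_mult_ineq] mult_right_mono) (simp_all add: norm_star)
  also have "\<dots> = (norm x * norm b)\<^sup>2"
    by (simp add: norm_rip[of x] power_mult_distrib power2_eq_square)
  finally show ?thesis
    by (rule power2_le_imp_le) simp
qed

end

context hilbert_bimodule
begin

lemma norm_ract_lact_le: "norm (ract (lact a x) b) \<le> norm a * norm b * norm x"
proof -
  have "norm (ract (lact a x) b) \<le> norm (lact a x) * norm b"
    by (rule norm_ract_le)
  also have "\<dots> \<le> (norm a * norm x) * norm b"
    by (intro mult_right_mono norm_lact_le) simp
  finally show ?thesis
    by (simp add: mult_ac)
qed

lemma cmod_dual_act_le:
  "cmod (cdual_apply f (ract (lact a x) b)) \<le> norm a * norm b * norm f * norm x"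
proof -
  have "cmod (cdual_apply f (ract (lact a x) b)) \<le> norm f * norm (ract (lact a x) b)"
    by (rule norm_cdual_apply_le)
  also have "\<dots> \<le> norm f * (norm a * norm b * norm x)"
    by (intro mult_left_mono norm_ract_lact_le) simp
  finally show ?thesis
    by (simp add: mult_ac)
qed

lemma dual_act_apply:
  "cdual_apply (dual_act lact ract a b f) x = cdual_apply f (ract (lact a x) b)"
proof -
  have l: "clinear (lact a)" and r: "clinear (\<lambda>x. ract x b)"
    using cbilinear_lact cbilinear_ract by (simp_all add: cbilinear_def)
  show ?thesis
    unfolding dual_act_def
    by (subst CDual_inverse'[OF _ _ cmod_dual_act_le])
      (simp_all add: clinear_add[OF l] clinear_add[OF r] clinear_scaleC[OF l]
        clinear_scaleC[OF r] cdual_apply_add cdual_apply_scaleC scaleC_complex_def)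
qed

lemma bidual_act_apply:
  "cdual_apply (bidual_act lact ract a t b) f = cdual_apply t (dual_act lact ract a b f)"
proof -
  have add: "dual_act lact ract a b (f + g) = dual_act lact ract a b f + dual_act lact ract a b g"
    for f g
    by (rule cdual_eqI) (simp add: dual_act_apply plus_cdual.rep_eq)
  have scale: "dual_act lact ract a b (c *\<^sub>C f) = c *\<^sub>C dual_act lact ract a b f" for c f
    by (rule cdual_eqI) (simp add: dual_act_apply scaleC_cdual.rep_eq)
  have bound: "cmod (cdual_apply t (dual_act lact ract a b f))
      \<le> (norm t * (norm a * norm b)) * norm f" for f
  proof -
    have "norm (dual_act lact ract a b f) \<le> norm a * norm b * norm f"
      by (rule norm_cdual_bound) (simp_all add: dual_act_apply cmod_dual_act_le)
    then have "norm t * norm (dual_act lact ract a b f) \<le> norm t * (norm a * norm b * norm f)"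
      by (intro mult_left_mono) simp_all
    then show ?thesis
      using norm_cdual_apply_le[of t "dual_act lact ract a b f"] by (simp add: mult_ac)
  qed
  show ?thesis
    unfolding bidual_act_def
    by (subst CDual_inverse'[OF _ _ bound])
      (simp_all add: add scale cdual_apply_add cdual_apply_scaleC scaleC_complex_def)
qed

end

end

theory Submission
  imports Defs
begin

text \<open>
  The inequality that makes \<open>t \<mapsto> q\<^sub>t\<close> isometric rather than merely contractive, and the construction
  of a preimage of a given quasi-multiplier, rest on one fact about the dual of a Hilbert bimodule
  (lemma \<open>dual_act_approx\<close>): for every functional \<open>f\<close> and every \<open>\<eta> > 0\<close> there are contractions
  \<open>a\<close>, \<open>b\<close> in the two algebras such that \<open>f\<close> and \<open>f(a \<cdot> b)\<close> are within \<open>\<eta>\<close> in norm. Then \<open>t(f)\<close>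
  is close to \<open>t(f(a \<cdot> b)) = f(q\<^sub>t(a, b))\<close>, so \<open>\<parallel>t\<parallel> \<le> \<parallel>q\<^sub>t\<parallel>\<close>. Conversely, given a
  quasi-multiplier \<open>q\<close>, put \<open>t(f) = lim f(q(e, u))\<close>, where \<open>e\<close> and \<open>u\<close> run through approximate
  units: \<open>f(q(e, u))\<close> is uniformly close to \<open>f(a q(e, u) b) = f(q(a e, u b))\<close>, which converges to
  \<open>f(q(a, b))\<close>; hence the limit exists, and the same computation gives \<open>a t b = q(a, b)\<close>.

  The fact about functionals comes from orthogonality. Let \<open>x\<close> in the unit ball almost attain
  \<open>\<parallel>f\<parallel>\<close> and let the self-adjoint contraction \<open>e\<close> almost fix \<open>x\<close>. For \<open>y\<close> in the unit ball,
  \<open>\<langle>x, (1 - e) y\<rangle>\<^sub>B = \<langle>(1 - e) x, y\<rangle>\<^sub>B\<close> is small, so \<open>\<parallel>x + s (1 - e) y\<parallel>\<^sup>2 \<le> 1 + 4 s\<^sup>2\<close> up to a small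
  error. If \<open>f((1 - e) y)\<close> were not small, then \<open>f\<close> would exceed its norm bound at such a vector,
  for small \<open>s\<close> and \<open>y\<close> of suitable phase. The left action has to be tested with the right inner product and
  vice versa, which is where both Hilbert module structures enter.

  The contraction \<open>e\<close> is \<open>h\<^sup>2 (h\<^sup>2 + \<rho>\<^sup>2)\<^sup>-\<^sup>1\<close> for small \<open>\<rho>\<close>, where \<open>h = \<langle>x, x\<rangle>\<close>. It is obtained
  without unitization or functional calculus as \<open>r\<^sup>* r\<close>, where \<open>r = h (h + i \<rho>)\<^sup>-\<^sup>1\<close> is constructed
  by fixed point arguments; \<open>1 - 2 r\<close> is a Cayley transform of \<open>h\<close>, hence unitary, which gives
  \<open>\<parallel>r\<parallel> \<le> 1\<close>.
\<close>

section \<open>Norming functionals\<close>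

definition sublinear :: "('a::real_vector \<Rightarrow> real) \<Rightarrow> bool"
  where "sublinear p \<longleftrightarrow>
    (\<forall>x y. p (x + y) \<le> p x + p y) \<and> (\<forall>c\<ge>0. \<forall>x. p (c *\<^sub>R x) \<le> c * p x)"

lemma sublinear_add: "sublinear p \<Longrightarrow> p (x + y) \<le> p x + p y"
  and sublinear_scale: "sublinear p \<Longrightarrow> 0 \<le> c \<Longrightarrow> p (c *\<^sub>R x) \<le> c * p x"
  by (simp_all add: sublinear_def)

lemma sublinear_zero: "sublinear p \<Longrightarrow> p 0 = 0"
  using sublinear_add[of p 0 0] sublinear_scale[of p 0 0] by simp

lemma sublinear_minus: "sublinear p \<Longrightarrow> - p (- x) \<le> p x"
  using sublinear_add[of p x "- x"] by (simp add: sublinear_zero)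

lemma cINF_add_greatest:
  fixes f :: "'a \<Rightarrow> real" and g :: "'b \<Rightarrow> real"
  assumes "A \<noteq> {}" "B \<noteq> {}" "\<And>a b. a \<in> A \<Longrightarrow> b \<in> B \<Longrightarrow> z \<le> f a + g b"
  shows "z \<le> (INF a\<in>A. f a) + (INF b\<in>B. g b)"
proof -
  have "z - g b \<le> (INF a\<in>A. f a)" if "b \<in> B" for b
    using assms(1) assms(3)[OF _ that] by (intro cINF_greatest) (auto simp: algebra_simps)
  then have "z - (INF a\<in>A. f a) \<le> (INF b\<in>B. g b)"
    using assms(2) by (intro cINF_greatest) (auto simp: algebra_simps)
  then show ?thesis
    by simp
qed

lemma cINF_mult_greatest:
  fixes f :: "'a \<Rightarrow> real"
  assumes "A \<noteq> {}" "0 \<le> c" "\<And>a. a \<in> A \<Longrightarrow> z \<le> c * f a"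
  shows "z \<le> c * (INF a\<in>A. f a)"
proof (cases "c = 0")
  case True
  then show ?thesis
    using assms by auto
next
  case False
  then have "z / c \<le> (INF a\<in>A. f a)"
    using assms by (intro cINF_greatest) (auto simp: field_simps)
  then show ?thesis
    using False assms(2) by (simp add: field_simps)
qed

text \<open>Lowers the slope in the direction \<open>- x\<close> to \<open>- p x\<close> while staying below \<open>p\<close>. A minimal sublinear
  functional is its own tilt in every direction, which forces it to be additive; tilting the norm
  at \<open>x\<close> forces every linear functional below to attain the norm at \<open>x\<close>.\<close>

definition tilt :: "('a::real_vector \<Rightarrow> real) \<Rightarrow> 'a \<Rightarrow> 'a \<Rightarrow> real"
  where "tilt p x y = (INF t\<in>{0..}. p (y + t *\<^sub>R x) - t * p x)"

lemma tilt_bdd_below: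
  assumes "sublinear p"
  shows "bdd_below ((\<lambda>t. p (y + t *\<^sub>R x) - t * p x) ` {0..})"
proof (rule bdd_belowI2)
  fix t :: real
  assume "t \<in> {0..}"
  have "p (y + t *\<^sub>R x) \<ge> - p (- y) + t * p x"
  proof (cases "t = 0")
    case True
    then show ?thesis
      using sublinear_minus[OF assms] by simp
  next
    case False
    then have t: "t > 0"
      using \<open>t \<in> {0..}\<close> by simp
    have "p x = p (inverse t *\<^sub>R (t *\<^sub>R x))"
      using t by simp
    also have "\<dots> \<le> inverse t * p (t *\<^sub>R x)"
      using t by (intro sublinear_scale[OF assms]) simp
    finally have "t * p x \<le> p (t *\<^sub>R x)"
      using t by (simp add: field_simps)
    also have "\<dots> \<le> p (y + t *\<^sub>R x) + p (- y)"
      using sublinear_add[OF assms, of "y + t *\<^sub>R x" "- y"] by simp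
    finally show ?thesis
      by simp
  qed
  then show "- p (- y) \<le> p (y + t *\<^sub>R x) - t * p x"
    by simp
qed

lemma tilt_le:
  "sublinear p \<Longrightarrow> 0 \<le> t \<Longrightarrow> tilt p x y \<le> p (y + t *\<^sub>R x) - t * p x"
  unfolding tilt_def by (rule cINF_lower[OF tilt_bdd_below]) simp_all

lemma sublinear_tilt:
  assumes "sublinear p"
  shows "sublinear (tilt p x)"
  unfolding sublinear_def
proof (intro conjI allI impI)
  fix y z
  show "tilt p x (y + z) \<le> tilt p x y + tilt p x z"
    unfolding tilt_def[of p x y] tilt_def[of p x z]
  proof (rule cINF_add_greatest)
    fix s t :: real
    assume "s \<in> {0..}" "t \<in> {0..}"
    then have "tilt p x (y + z) \<le> p (y + z + (s + t) *\<^sub>R x) - (s + t) * p x"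
      by (intro tilt_le assms) simp
    also have "y + z + (s + t) *\<^sub>R x = (y + s *\<^sub>R x) + (z + t *\<^sub>R x)"
      by (simp add: algebra_simps)
    also have "p \<dots> - (s + t) * p x \<le> p (y + s *\<^sub>R x) + p (z + t *\<^sub>R x) - (s + t) * p x"
      by (intro diff_right_mono sublinear_add[OF assms])
    finally show "tilt p x (y + z) \<le> p (y + s *\<^sub>R x) - s * p x + (p (z + t *\<^sub>R x) - t * p x)"
      by (simp add: algebra_simps)
  qed simp_all
next
  fix c :: real and y
  assume c: "0 \<le> c"
  show "tilt p x (c *\<^sub>R y) \<le> c * tilt p x y"
    unfolding tilt_def[of p x y]
  proof (rule cINF_mult_greatest)
    fix t :: real
    assume "t \<in> {0..}"
    then have "tilt p x (c *\<^sub>R y) \<le> p (c *\<^sub>R y + (c * t) *\<^sub>R x) - (c * t) * p x"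
      using c by (intro tilt_le assms) simp
    also have "\<dots> = p (c *\<^sub>R (y + t *\<^sub>R x)) - c * (t * p x)"
      by (simp add: algebra_simps)
    also have "\<dots> \<le> c * p (y + t *\<^sub>R x) - c * (t * p x)"
      by (intro diff_right_mono sublinear_scale[OF assms c])
    finally show "tilt p x (c *\<^sub>R y) \<le> c * (p (y + t *\<^sub>R x) - t * p x)"
      by (simp add: algebra_simps)
  qed (simp_all add: c)
qed

lemma minimal_sublinear:
  fixes p :: "'a::real_vector \<Rightarrow> real"
  assumes "sublinear p"
  obtains m where "sublinear m" "m \<le> p" "\<And>q. sublinear q \<Longrightarrow> q \<le> m \<Longrightarrow> q = m"
proof -
  define S where "S = {q. sublinear q \<and> q \<le> p}"
  have "\<exists>m\<in>S. \<forall>q\<in>S. q \<le> m \<longrightarrow> q = m"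
  proof (rule predicate_Zorn[where P = "\<lambda>f g. g \<le> f"])
    show "partial_order_on S (relation_of (\<lambda>f g. g \<le> f) S)"
      by (rule partial_order_on_relation_ofI) auto
  next
    fix C
    assume C: "C \<in> Chains (relation_of (\<lambda>f g. g \<le> f) S)"
    have CS: "C \<subseteq> S"
      using C by (auto simp: Chains_def relation_of_def)
    have tot: "f \<le> g \<or> g \<le> f" if "f \<in> C" "g \<in> C" for f g
      using C that by (auto simp: Chains_def relation_of_def)
    show "\<exists>u\<in>S. \<forall>q\<in>C. u \<le> q"
    proof (cases "C = {}")
      case True
      then show ?thesis
        using assms by (auto simp: S_def)
    next
      case False
      define u where "u x = (INF q\<in>C. q x)" for x
      have lower: "u x \<le> q x" if "q \<in> C" for q x
        unfolding u_def
      proof (rule cINF_lower[OF bdd_belowI2 that])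
        fix q
        assume "q \<in> C"
        then have "sublinear q" "q (- x) \<le> p (- x)"
          using CS by (auto simp: S_def le_fun_def)
        then show "- p (- x) \<le> q x"
          using sublinear_minus[of q x] by simp
      qed
      have "u (x + y) \<le> u x + u y" for x y
        unfolding u_def[of x] u_def[of y]
      proof (rule cINF_add_greatest[OF False False])
        fix f g
        assume fg: "f \<in> C" "g \<in> C"
        then obtain h where h: "h \<in> C" "h \<le> f" "h \<le> g"
          using tot by blast
        have "u (x + y) \<le> h (x + y)"
          by (rule lower[OF h(1)])
        also have "\<dots> \<le> h x + h y"
          using h(1) CS by (intro sublinear_add) (auto simp: S_def)
        also have "\<dots> \<le> f x + g y"
          using h by (intro add_mono) (auto simp: le_fun_def)
        finally show "u (x + y) \<le> f x + g y" .
      qed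
      moreover have "u (c *\<^sub>R x) \<le> c * u x" if "0 \<le> c" for c x
        unfolding u_def[of x]
      proof (rule cINF_mult_greatest[OF False that])
        fix q
        assume "q \<in> C"
        then show "u (c *\<^sub>R x) \<le> c * q x"
          using lower[of q "c *\<^sub>R x"] sublinear_scale[of q c x] CS that by (force simp: S_def)
      qed
      ultimately have "sublinear u"
        by (simp add: sublinear_def)
      moreover obtain q where "q \<in> C"
        using False by blast
      then have "u \<le> p"
        using lower[of q] CS unfolding S_def le_fun_def by (blast intro: order_trans)
      ultimately show ?thesis
        using lower by (auto simp: S_def le_fun_def)
    qed
  qed
  then obtain m where "m \<in> S" "\<And>q. q \<in> S \<Longrightarrow> q \<le> m \<Longrightarrow> q = m"
    by blast
  then show thesis
    by (intro that[of m]) (auto simp: S_def intro: order_trans)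
qed

lemma linear_below_sublinear:
  fixes p :: "'a::real_vector \<Rightarrow> real"
  assumes "sublinear p"
  obtains f where "linear f" "\<And>x. f x \<le> p x"
proof -
  obtain m where m: "sublinear m" "m \<le> p" "\<And>q. sublinear q \<Longrightarrow> q \<le> m \<Longrightarrow> q = m"
    using minimal_sublinear[OF assms] by blast
  have "tilt m x = m" for x
    using tilt_le[OF m(1), of 0 x] by (intro m sublinear_tilt) (simp add: le_fun_def)
  then have add: "m (x + y) = m x + m y" for x y
    using tilt_le[OF m(1), of 1 x y] sublinear_add[OF m(1), of x y] by (simp add: add.commute)
  have minus: "m (- x) = - m x" for x
    using add[of x "- x"] sublinear_zero[OF m(1)] by simp
  have pos: "m (c *\<^sub>R x) = c * m x" if "0 \<le> c" for c x
    using sublinear_scale[OF m(1) that, of x] sublinear_scale[OF m(1) that, of "- x"]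
    by (simp add: minus)
  have "m (c *\<^sub>R x) = c * m x" for c x
    using pos[of c x] pos[of "- c" x] by (cases "0 \<le> c") (simp_all add: minus)
  then have "linear m"
    by (intro linearI) (simp_all add: add)
  with m(2) show thesis
    by (intro that[of m]) (auto simp: le_fun_def)
qed

lemma rotate_to_nonneg:
  obtains u :: complex where "cmod u = 1" "u * z = complex_of_real (cmod z)"
proof (cases "z = 0")
  case True
  then show thesis
    by (intro that[of 1]) simp_all
next
  case False
  then show thesis
    using complex_norm_square[of z]
    by (intro that[of "cnj z / cmod z"])
      (simp_all add: norm_divide field_simps power2_eq_square)
qed

text \<open>The complex form of the Hahn--Banach theorem. It makes the embedding into the bidual isometric,
  hence injective, so that \<^const>\<open>quasi_multiplier_of\<close> has the intended values.\<close>

lemma norming_functional: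
  fixes x :: "'v::complex_normed_vector"
  obtains f :: "'v cdual" where "norm f \<le> 1" "cdual_apply f x = norm x"
proof -
  have sub: "sublinear (norm :: 'v \<Rightarrow> real)"
    by (simp add: sublinear_def norm_triangle_ineq)
  obtain g where g: "linear g" "\<And>y. g y \<le> tilt norm x y"
    using linear_below_sublinear[OF sublinear_tilt[OF sub]] by blast
  have g_le: "g y \<le> norm y" for y
    using g(2)[of y] tilt_le[OF sub, of 0 x y] by simp
  have "- g x \<le> - norm x"
    using g(2)[of "- x"] tilt_le[OF sub, of 1 x "- x"] linear_neg[OF g(1), of x] by simp
  then have g_x: "g x = norm x"
    using g_le[of x] by simp
  define h where "h y = Complex (g y) (- g (\<i> *\<^sub>C y))" for y
  have add: "h (y + z) = h y + h z" for y z
    by (simp add: h_def complex_eq_iff linear_add[OF g(1)] scaleC_add_right)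
  have g_scaleC: "g (c *\<^sub>C y) = Re c * g y + Im c * g (\<i> *\<^sub>C y)" for c y
  proof -
    have "c *\<^sub>C y = Re c *\<^sub>R y + Im c *\<^sub>R (\<i> *\<^sub>C y)"
      unfolding scaleR_scaleC scaleC_scaleC scaleC_add_left[symmetric]
      by (simp add: complex_eq mult.commute)
    then show ?thesis
      by (simp add: linear_add[OF g(1)] linear_scale[OF g(1)])
  qed
  have scale: "h (c *\<^sub>C y) = c * h y" for c y
    by (simp add: h_def complex_eq_iff g_scaleC[of c] scaleC_scaleC g_scaleC[of "\<i> * c"])
  have bound: "cmod (h y) \<le> 1 * norm y" for y
  proof -
    obtain u where u: "cmod u = 1" "u * h y = complex_of_real (cmod (h y))"
      using rotate_to_nonneg by blast
    have "cmod (h y) = Re (h (u *\<^sub>C y))"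
      by (simp add: scale u)
    also have "\<dots> \<le> norm (u *\<^sub>C y)"
      by (simp add: h_def g_le)
    finally show ?thesis
      by (simp add: norm_scaleC u)
  qed
  have h_apply: "cdual_apply (CDual h) = h"
    by (rule CDual_inverse'[OF add scale bound])
  have "h x = norm x"
  proof -
    have "(Re (h x))\<^sup>2 + (Im (h x))\<^sup>2 \<le> (norm x)\<^sup>2"
      using power_mono[OF bound[of x], of 2] by (simp add: cmod_power2)
    moreover have "Re (h x) = norm x"
      by (simp add: h_def g_x)
    ultimately show ?thesis
      by (simp add: complex_eq_iff)
  qed
  then show thesis
    using bound by (intro that[of "CDual h"]) (auto simp: h_apply intro!: norm_cdual_bound)
qed

lemma norm_bidual_embed: "norm (bidual_embed x) = norm x"
proof (rule antisym)
  show "norm (bidual_embed x) \<le> norm x"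
    by (rule norm_cdual_bound)
      (simp_all add: bidual_embed_apply norm_cdual_apply_le[THEN order_trans] mult.commute)
  obtain f :: "'a cdual" where f: "norm f \<le> 1" "cdual_apply f x = norm x"
    using norming_functional .
  have "norm x = cmod (cdual_apply (bidual_embed x) f)"
    by (simp add: bidual_embed_apply f)
  also have "\<dots> \<le> norm (bidual_embed x) * norm f"
    by (rule norm_cdual_apply_le)
  also have "\<dots> \<le> norm (bidual_embed x)"
    using f(1) by (simp add: mult_left_le)
  finally show "norm x \<le> norm (bidual_embed x)" .
qed

lemma bidual_embed_add: "bidual_embed (x + y) = bidual_embed x + bidual_embed y"
  by (rule cdual_eqI) (simp add: bidual_embed_apply plus_cdual.rep_eq cdual_apply_add)

lemma bidual_embed_scaleC: "bidual_embed (c *\<^sub>C x) = c *\<^sub>C bidual_embed x"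
  by (rule cdual_eqI)
    (simp add: bidual_embed_apply scaleC_cdual.rep_eq cdual_apply_scaleC scaleC_complex_def)

lemma bidual_embed_eq_iff: "bidual_embed x = bidual_embed y \<longleftrightarrow> x = y"
proof
  assume eq: "bidual_embed x = bidual_embed y"
  have "x = (x - y) + y"
    by simp
  then have "bidual_embed (x - y) = 0"
    using eq bidual_embed_add[of "x - y" y] by simp
  then show "x = y"
    using norm_bidual_embed[of "x - y"] by simp
qed simp

section \<open>Approximate units\<close>

lemma star_diff: "star (x - y) = star x - star (y::'a::cstar_algebra)"
  using star_add[of "x - y" y] by simp

lemma star_scaleR: "star (r *\<^sub>R x) = r *\<^sub>R star (x::'a::cstar_algebra)"
  by (simp add: scaleR_scaleC star_scaleC)

lemma self_star_mult_eq_0: "x * star x = 0 \<Longrightarrow> x = (0::'a::cstar_algebra)"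
  using norm_star_mult[of "star x"] by (simp add: star_star norm_star)

text \<open>The equation says \<open>r (a + i \<rho>) = a\<close>, that is \<open>r = a (a + i \<rho>)\<^sup>-\<^sup>1\<close>, in a form which makes sense in an
  algebra without unit.\<close>

definition resolvent_unit :: "'a::cstar_algebra \<Rightarrow> real \<Rightarrow> 'a \<Rightarrow> bool"
  where "resolvent_unit a \<rho> r \<longleftrightarrow> r * a + (\<i> * \<rho>) *\<^sub>C r = a"

text \<open>The commutator \<open>d\<close> of \<open>a\<close> and \<open>r\<close> satisfies \<open>d a = - i \<rho> d\<close>. As \<open>d a d\<^sup>*\<close> and \<open>d d\<^sup>*\<close> are both
  self-adjoint, the imaginary factor forces \<open>d d\<^sup>* = 0\<close>.\<close>

lemma resolvent_unit_commute:
  fixes a :: "'a::cstar_algebra"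
  assumes a: "star a = a" and \<rho>: "\<rho> \<noteq> 0" and r: "resolvent_unit a \<rho> r"
  shows "a * r = r * a"
proof -
  define d where "d = a * r - r * a"
  have "a * (r * a + (\<i> * \<rho>) *\<^sub>C r) = (r * a + (\<i> * \<rho>) *\<^sub>C r) * a"
    using r by (simp add: resolvent_unit_def)
  then have d: "d * a = - ((\<i> * \<rho>) *\<^sub>C d)"
    by (simp add: d_def algebra_simps scaleC_mult_left scaleC_mult_right
        complex_vector.scale_right_diff_distrib)
  have 1: "d * a * star d = - ((\<i> * \<rho>) *\<^sub>C (d * star d))"
    by (simp add: d scaleC_mult_left)
  have "star (d * a * star d) = d * a * star d"
    by (simp add: star_mult star_star a mult.assoc)
  then have "star (- ((\<i> * \<rho>) *\<^sub>C (d * star d))) = - ((\<i> * \<rho>) *\<^sub>C (d * star d))"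
    unfolding 1 .
  moreover have "star (- ((\<i> * \<rho>) *\<^sub>C (d * star d))) = (\<i> * \<rho>) *\<^sub>C (d * star d)"
    using star_diff[of 0 "(\<i> * \<rho>) *\<^sub>C (d * star d)"] star_diff[of 0 "0::'a"]
    by (simp add: star_scaleC star_mult star_star)
  ultimately have "(\<i> * \<rho>) *\<^sub>C (d * star d) = 0"
    by (simp add: eq_neg_iff_add_eq_0 flip: scaleR_2)
  then have "d * star d = 0"
    using \<rho> by simp
  then show ?thesis
    using self_star_mult_eq_0[of d] by (simp add: d_def)
qed

text \<open>This is the identity \<open>(1 - 2 r)\<^sup>* (1 - 2 r) = 1\<close> with the unit cancelled.\<close>

lemma resolvent_unit_star_mult:
  fixes a :: "'a::cstar_algebra"
  assumes a: "star a = a" and \<rho>: "\<rho> \<noteq> 0" and r: "resolvent_unit a \<rho> r"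
  shows "2 *\<^sub>R (star r * r) = r + star r"
proof -
  have 1: "(\<i> * \<rho>) *\<^sub>C r = a - a * r"
    using r resolvent_unit_commute[OF assms] by (simp add: resolvent_unit_def algebra_simps)
  have 2: "(\<i> * \<rho>) *\<^sub>C star r = star r * a - a"
    using arg_cong[OF 1, of star]
    by (simp add: star_scaleC star_diff star_mult a algebra_simps)
  have "(\<i> * \<rho>) *\<^sub>C (2 *\<^sub>R (star r * r)) = star r * ((\<i> * \<rho>) *\<^sub>C r) + ((\<i> * \<rho>) *\<^sub>C star r) * r"
    by (simp add: scaleC_mult_right scaleC_mult_left scaleC_add_right scaleR_2)
  also have "\<dots> = star r * a - a * r"
    unfolding 1 2 by (simp add: algebra_simps)
  also have "\<dots> = (\<i> * \<rho>) *\<^sub>C (r + star r)"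
    unfolding scaleC_add_right 1 2 by simp
  finally show ?thesis
    using \<rho> by simp
qed

lemma resolvent_unit_norm_le:
  fixes a :: "'a::cstar_algebra"
  assumes "star a = a" "\<rho> \<noteq> 0" "resolvent_unit a \<rho> r"
  shows "norm r \<le> 1"
proof -
  have "2 * (norm r)\<^sup>2 = norm (r + star r)"
    by (simp add: resolvent_unit_star_mult[OF assms, symmetric] norm_star_mult)
  also have "\<dots> \<le> 2 * norm r"
    using norm_triangle_ineq[of r "star r"] by (simp add: norm_star)
  finally show ?thesis
    by (cases "norm r = 0") (simp_all add: power2_eq_square)
qed

text \<open>For large \<open>\<rho>\<close> the defining equation is a contractive fixed point equation. The bound
  \<open>\<parallel>r\<parallel> \<le> 1\<close> does not depend on \<open>\<rho>\<close>, so solutions can be continued from \<open>\<rho>\<close> to \<open>2 \<rho> / 3\<close>, again by a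
  fixed point argument, and thus reach arbitrarily small \<open>\<rho>\<close>.\<close>

lemma resolvent_unit_large:
  fixes a :: "'a::cstar_algebra"
  assumes "norm a < \<rho>"
  shows "\<exists>r. resolvent_unit a \<rho> r"
proof -
  have \<rho>: "\<rho> > 0"
    using assms norm_ge_zero[of a] by linarith
  define F where "F r = (1 / (\<i> * \<rho>)) *\<^sub>C (a - r * a)" for r
  have "\<exists>!r. F r = r"
  proof (rule banach_fix_type[of "norm a / \<rho>"])
    show "\<forall>x y. dist (F x) (F y) \<le> norm a / \<rho> * dist x y"
    proof (intro allI)
      fix x y
      have "F x - F y = (1 / (\<i> * \<rho>)) *\<^sub>C ((y - x) * a)"
        unfolding F_def complex_vector.scale_right_diff_distrib[symmetric]
        by (simp add: algebra_simps)
      then have "dist (F x) (F y) = norm ((y - x) * a) / \<rho>"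
        using \<rho> by (simp add: dist_norm norm_scaleC norm_divide norm_mult)
      also have "\<dots> \<le> norm (y - x) * norm a / \<rho>"
        using \<rho> by (intro divide_right_mono norm_mult_ineq) simp
      finally show "dist (F x) (F y) \<le> norm a / \<rho> * dist x y"
        by (simp add: dist_norm norm_minus_commute mult.commute)
    qed
  qed (use assms \<rho> in simp_all)
  then obtain r where r: "F r = r"
    by blast
  have "(\<i> * \<rho>) *\<^sub>C r = a - r * a"
    using \<rho> unfolding r[symmetric, THEN arg_cong[of _ _ "\<lambda>z. (\<i> * \<rho>) *\<^sub>C z"]]
    by (simp add: F_def scaleC_scaleC)
  then show ?thesis
    by (intro exI[of _ r]) (simp add: resolvent_unit_def)
qed

lemma resolvent_unit_step:
  fixes a :: "'a::cstar_algebra"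
  assumes a: "star a = a" and \<rho>: "\<rho> > 0" and r: "resolvent_unit a \<rho> r"
  shows "\<exists>s. resolvent_unit a (2 / 3 * \<rho>) s"
proof -
  have r1: "norm r \<le> 1"
    using assms by (intro resolvent_unit_norm_le[OF a _ r]) simp
  \<comment> \<open>Multiplying the equation for \<open>s\<close> by \<open>(a + i \<rho>)\<^sup>-\<^sup>1\<close>, where \<open>y (a + i \<rho>)\<^sup>-\<^sup>1 = (y - y r) / (i \<rho>)\<close>,
    turns it into \<open>s = r + (s - s r) / 3\<close>.\<close>
  define F where "F s = r + (1 / 3) *\<^sub>R (s - s * r)" for s
  have "\<exists>!s. F s = s"
  proof (rule banach_fix_type[of "2 / 3"])
    show "\<forall>x y. dist (F x) (F y) \<le> 2 / 3 * dist x y"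
    proof (intro allI)
      fix x y
      have "F x - F y = (1 / 3) *\<^sub>R ((x - y) - (x - y) * r)"
        by (simp add: F_def algebra_simps)
      then have "dist (F x) (F y) = norm ((x - y) - (x - y) * r) / 3"
        by (simp add: dist_norm)
      also have "norm ((x - y) - (x - y) * r) \<le> norm (x - y) + norm (x - y) * norm r"
        by (intro order_trans[OF norm_triangle_ineq4] add_left_mono norm_mult_ineq)
      also have "norm (x - y) * norm r \<le> norm (x - y)"
        using r1 by (simp add: mult_left_le)
      finally show "dist (F x) (F y) \<le> 2 / 3 * dist x y"
        by (simp add: dist_norm)
    qed
  qed simp_all
  then obtain s where s: "r + (1 / 3) *\<^sub>R (s - s * r) = s"
    by (auto simp: F_def)
  have r': "r * a = a - (\<i> * \<rho>) *\<^sub>C r"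
    using r by (simp add: resolvent_unit_def algebra_simps)
  have 3: "3 *\<^sub>R s = 3 *\<^sub>R r + s - s * r"
  proof -
    have "3 *\<^sub>R s = 3 *\<^sub>R (r + (1 / 3) *\<^sub>R (s - s * r))"
      unfolding s ..
    then show ?thesis
      by (simp add: algebra_simps)
  qed
  let ?w = "\<i> * complex_of_real \<rho>"
  have "3 *\<^sub>R (s * a + ?w *\<^sub>C s) = (3 *\<^sub>R s) * a + ?w *\<^sub>C (3 *\<^sub>R s)"
    by (simp add: scaleR_scaleC scaleC_add_right scaleC_scaleC scaleC_mult_left mult.commute)
  also have "\<dots> = 3 *\<^sub>R (r * a + ?w *\<^sub>C r) + (s * a - s * (r * a)) + ?w *\<^sub>C (s - s * r)"
    unfolding 3
    by (simp add: scaleR_scaleC scaleC_add_right scaleC_scaleC scaleC_mult_left mult.commute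
        algebra_simps complex_vector.scale_right_diff_distrib)
  also have "\<dots> = 3 *\<^sub>R a + ?w *\<^sub>C s"
    unfolding r' by (simp add: algebra_simps scaleC_mult_right complex_vector.scale_right_diff_distrib)
  finally have "3 *\<^sub>R (s * a + ?w *\<^sub>C s) - ?w *\<^sub>C s = 3 *\<^sub>R a"
    by simp
  also have "3 *\<^sub>R (s * a + ?w *\<^sub>C s) - ?w *\<^sub>C s = 3 *\<^sub>R (s * a + (\<i> * complex_of_real (2 / 3 * \<rho>)) *\<^sub>C s)"
    by (simp add: scaleR_scaleC scaleC_add_right scaleC_scaleC
        complex_vector.scale_left_diff_distrib[symmetric] add_diff_eq[symmetric])
  finally show ?thesis
    by (auto simp: resolvent_unit_def)
qed

lemma resolvent_unit_exists_below:
  fixes a :: "'a::cstar_algebra"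
  assumes a: "star a = a" and \<epsilon>: "\<epsilon> > 0"
  obtains \<rho> r where "0 < \<rho>" "\<rho> < \<epsilon>" "resolvent_unit a \<rho> r"
proof -
  define R where "R n = (2 / 3) ^ n * (norm a + 1)" for n :: nat
  have pos: "R n > 0" for n
    unfolding R_def by (intro mult_pos_pos) (simp_all add: add_nonneg_pos)
  have "\<exists>r. resolvent_unit a (R n) r" for n
  proof (induction n)
    case 0
    then show ?case
      by (simp add: R_def resolvent_unit_large)
  next
    case (Suc n)
    then obtain r where "resolvent_unit a (R n) r" ..
    then show ?case
      using resolvent_unit_step[OF a pos] by (simp add: R_def mult.assoc)
  qed
  moreover have "R \<longlonglongrightarrow> 0 * (norm a + 1)"
    unfolding R_def by (intro tendsto_mult LIMSEQ_power_zero tendsto_const) simp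
  then have "\<forall>\<^sub>F n in sequentially. R n < \<epsilon>"
    using \<epsilon> by (intro order_tendstoD(2)) simp
  then obtain n where "R n < \<epsilon>"
    using eventually_happens by fastforce
  ultimately show thesis
    using pos that by blast
qed

definition sa_contraction :: "'a::cstar_algebra \<Rightarrow> bool"
  where "sa_contraction e \<longleftrightarrow> star e = e \<and> norm e \<le> 1"

text \<open>Since \<open>e = r\<^sup>* r = (r + r\<^sup>*) / 2\<close>, the difference \<open>a - a e\<close> is the mean of \<open>a - a r = i \<rho> r\<close> and
  \<open>a - a r\<^sup>* = - i \<rho> r\<^sup>*\<close>, so its norm is at most \<open>\<rho>\<close>.\<close>

lemma sa_contraction_approx:
  fixes a :: "'a::cstar_algebra"
  assumes a: "star a = a" and \<epsilon>: "\<epsilon> > 0"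
  obtains e where "sa_contraction e" "norm (a - a * e) < \<epsilon>"
proof -
  obtain \<rho> r where \<rho>: "0 < \<rho>" "\<rho> < \<epsilon>" and r: "resolvent_unit a \<rho> r"
    using resolvent_unit_exists_below[OF assms] .
  have \<rho>0: "\<rho> \<noteq> 0"
    using \<rho> by simp
  note sm = resolvent_unit_star_mult[OF a \<rho>0 r]
  note r1 = resolvent_unit_norm_le[OF a \<rho>0 r]
  define e where "e = star r * r"
  have "(norm r)\<^sup>2 \<le> 1"
    using power_mono[OF r1, of 2] by simp
  then have e: "sa_contraction e"
    by (simp add: sa_contraction_def e_def star_mult star_star norm_star_mult)
  have 1: "a - a * r = (\<i> * \<rho>) *\<^sub>C r"
    using r resolvent_unit_commute[OF a \<rho>0 r] by (simp add: resolvent_unit_def algebra_simps)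
  have 2: "a - a * star r = - ((\<i> * \<rho>) *\<^sub>C star r)"
  proof -
    have "r * a = a - (\<i> * \<rho>) *\<^sub>C r"
      using r by (simp add: resolvent_unit_def algebra_simps)
    from arg_cong[OF this, of star] show ?thesis
      by (simp add: star_scaleC star_diff star_mult a)
  qed
  have "2 *\<^sub>R (a - a * e) = 2 *\<^sub>R a - a * (2 *\<^sub>R e)"
    by (simp add: scaleR_diff_right)
  also have "\<dots> = (a - a * r) + (a - a * star r)"
    unfolding e_def sm by (simp add: scaleR_2 algebra_simps)
  also have "norm \<dots> \<le> norm (a - a * r) + norm (a - a * star r)"
    by (rule norm_triangle_ineq)
  also have "\<dots> = 2 * \<rho> * norm r"
    using \<rho> unfolding 1 2 by (simp add: norm_scaleC norm_star norm_mult)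
  also have "\<dots> \<le> 2 * \<rho>"
    using r1 \<rho> by (simp add: mult_left_le)
  finally have "norm (a - a * e) \<le> \<rho>"
    by simp
  then show thesis
    using that[OF e] \<rho> by simp
qed

lemma norm_compress_le:
  fixes d :: "'a::cstar_algebra"
  assumes "sa_contraction e"
  shows "norm (d - e * d) \<le> 2 * norm d" "norm (d - d * e) \<le> 2 * norm d"
proof -
  have "norm (e * d) \<le> norm d"
    using assms norm_mult_ineq[of e d] mult_right_mono[of "norm e" 1 "norm d"]
    by (simp add: sa_contraction_def)
  then show "norm (d - e * d) \<le> 2 * norm d"
    using norm_triangle_ineq4[of d "e * d"] by simp
  have "norm (d * e) \<le> norm d"
    using assms norm_mult_ineq[of d e] mult_left_mono[of "norm e" 1 "norm d"]
    by (simp add: sa_contraction_def)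
  then show "norm (d - d * e) \<le> 2 * norm d"
    using norm_triangle_ineq4[of d "d * e"] by simp
qed

lemma sa_contraction_right_approx:
  fixes a :: "'a::cstar_algebra"
  assumes \<epsilon>: "\<epsilon> > 0"
  obtains e where "sa_contraction e" "norm (a - a * e) < \<epsilon>"
proof -
  define h where "h = star a * a"
  have "star h = h"
    by (simp add: h_def star_mult star_star)
  then obtain e where e: "sa_contraction e" "norm (h - h * e) < \<epsilon>\<^sup>2 / 2"
    using sa_contraction_approx[of h "\<epsilon>\<^sup>2 / 2"] \<epsilon> by auto
  have "star (a - a * e) * (a - a * e) = (h - h * e) - e * (h - h * e)"
    using e(1) by (simp add: h_def sa_contraction_def star_diff star_mult algebra_simps)
  then have "(norm (a - a * e))\<^sup>2 = norm ((h - h * e) - e * (h - h * e))"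
    by (simp flip: norm_star_mult)
  also have "\<dots> < \<epsilon>\<^sup>2"
    using norm_compress_le(1)[OF e(1), of "h - h * e"] e(2) by simp
  finally have "norm (a - a * e) < \<epsilon>"
    using \<epsilon> power_less_imp_less_base[of _ 2 \<epsilon>] by force
  then show thesis
    using that e(1) by blast
qed

text \<open>If \<open>1 - g = (1 - e\<^sub>1) (1 - e\<^sub>2)\<close>, then \<open>g\<close> is a right unit up to \<open>\<epsilon>\<close> for the old elements and the
  new one, but in general neither self-adjoint nor contractive. A self-adjoint contraction \<open>e\<close> that almost fixes
  \<open>g\<close> from the right inherits this property, because \<open>a (1 - e)\<close> is close to \<open>a g (1 - e)\<close>. The
  bound \<open>1\<close> on the norm thus survives the induction.\<close>

lemma sa_contraction_finite_approx:
  fixes S :: "'a::cstar_algebra set"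
  assumes "finite S" "\<epsilon> > 0"
  shows "\<exists>e. sa_contraction e \<and> (\<forall>a\<in>S. norm (a - a * e) < \<epsilon>)"
  using assms
proof (induction arbitrary: \<epsilon> rule: finite_induct)
  case empty
  then show ?case
    using sa_contraction_right_approx[of \<epsilon> 0] by auto
next
  case (insert b S)
  obtain e1 where e1: "sa_contraction e1" "\<And>a. a \<in> S \<Longrightarrow> norm (a - a * e1) < \<epsilon> / 8"
    using insert.IH[of "\<epsilon> / 8"] insert.prems by auto
  obtain e2 where e2: "sa_contraction e2" "norm ((b - b * e1) - (b - b * e1) * e2) < \<epsilon> / 8"
    using sa_contraction_right_approx[of "\<epsilon> / 8" "b - b * e1"] insert.prems by auto
  define g where "g = e1 + e2 - e1 * e2"
  define M where "M = (\<Sum>a\<in>insert b S. norm a) + 1"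
  have M: "norm a \<le> M" "M > 0" if "a \<in> insert b S" for a
  proof -
    show "norm a \<le> M"
      unfolding M_def using insert.hyps that
      by (intro add_increasing2 member_le_sum) auto
    show "M > 0"
      unfolding M_def by (intro add_nonneg_pos sum_nonneg) auto
  qed
  obtain e where e: "sa_contraction e" "norm (g - g * e) < \<epsilon> / (2 * M)"
    using sa_contraction_right_approx[of "\<epsilon> / (2 * M)" g] insert.prems M(2)[OF insertI1] by auto
  have g: "a - a * g = (a - a * e1) - (a - a * e1) * e2" for a
    by (simp add: g_def algebra_simps)
  have "norm (a - a * e) < \<epsilon>" if a: "a \<in> insert b S" for a
  proof -
    have "norm (a - a * g) < \<epsilon> / 4"
    proof (cases "a = b")
      case True
      then show ?thesis
        using e2(2) insert.prems by (simp add: g)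
    next
      case False
      then show ?thesis
        using a e1(2)[of a] norm_compress_le(2)[OF e2(1), of "a - a * e1"] by (simp add: g)
    qed
    moreover have "norm (a * (g - g * e)) \<le> \<epsilon> / 2"
    proof -
      have "norm (a * (g - g * e)) \<le> norm a * norm (g - g * e)"
        by (rule norm_mult_ineq)
      also have "\<dots> \<le> M * (\<epsilon> / (2 * M))"
        using M[OF a] e(2) by (intro mult_mono) auto
      finally show ?thesis
        using M(2)[OF a] by simp
    qed
    moreover have "a - a * e = ((a - a * g) - (a - a * g) * e) + a * (g - g * e)"
      by (simp add: algebra_simps)
    ultimately have "norm (a - a * e) \<le> norm ((a - a * g) - (a - a * g) * e) + norm (a * (g - g * e))"
      by (metis norm_triangle_ineq)
    with \<open>norm (a - a * g) < \<epsilon> / 4\<close> \<open>norm (a * (g - g * e)) \<le> \<epsilon> / 2\<close> show ?thesis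
      using norm_compress_le(2)[OF e(1), of "a - a * g"] by linarith
  qed
  then show ?case
    using e(1) by blast
qed

text \<open>A filter instead of a net: its basic sets ask a self-adjoint contraction to act on finitely many
  given elements almost as a right unit, and it is proper by the previous lemma.\<close>

definition approx_unit :: "'a::cstar_algebra filter"
  where "approx_unit = (INF p\<in>UNIV \<times> {0<..}.
    principal {e. sa_contraction e \<and> norm (fst p - fst p * e) < snd p})"

lemma approx_unit_neq_bot: "approx_unit \<noteq> (bot :: 'a::cstar_algebra filter)"
  unfolding approx_unit_def
proof (rule INF_filter_not_bot)
  fix X :: "('a \<times> real) set"
  assume X: "X \<subseteq> UNIV \<times> {0<..}" "finite X"
  define \<epsilon> where "\<epsilon> = Min (insert 1 (snd ` X))"
  have "\<epsilon> > 0"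
    using X by (auto simp: \<epsilon>_def)
  then obtain e where e: "sa_contraction e" "\<And>a. a \<in> fst ` X \<Longrightarrow> norm (a - a * e) < \<epsilon>"
    using sa_contraction_finite_approx[of "fst ` X" \<epsilon>] X(2) by blast
  have "norm (fst p - fst p * e) < snd p" if "p \<in> X" for p
  proof -
    have "\<epsilon> \<le> snd p"
      unfolding \<epsilon>_def using X(2) that by (intro Min_le) auto
    then show ?thesis
      using e(2)[of "fst p"] that by force
  qed
  then have "e \<in> (\<Inter>p\<in>X. {e. sa_contraction e \<and> norm (fst p - fst p * e) < snd p})"
    using e(1) by blast
  then show "(INF p\<in>X. principal {e. sa_contraction e \<and> norm (fst p - fst p * e) < snd p}) \<noteq> bot"
    unfolding INF_principal_finite[OF X(2)] principal_eq_bot_iff by blast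
qed

lemma eventually_approx_unit:
  assumes "\<epsilon> > 0"
  shows "\<forall>\<^sub>F e in approx_unit. sa_contraction e \<and> norm (a - a * e) < \<epsilon>"
  unfolding approx_unit_def
  by (rule eventually_INF1[of "(a, \<epsilon>)"]) (use assms in \<open>auto simp: eventually_principal\<close>)

lemma eventually_approx_unit_sa_contraction: "\<forall>\<^sub>F e in approx_unit. sa_contraction e"
  using eventually_approx_unit[of 1 0] by (auto elim: eventually_mono)

lemma tendsto_approx_unit_right: "((\<lambda>e. a * e) \<longlongrightarrow> a) approx_unit"
proof (rule tendstoI)
  fix \<epsilon> :: real
  assume "\<epsilon> > 0"
  then show "\<forall>\<^sub>F e in approx_unit. dist (a * e) a < \<epsilon>"
    by (rule eventually_mono[OF eventually_approx_unit[of \<epsilon> a]])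
      (simp add: dist_norm norm_minus_commute)
qed

lemma tendsto_approx_unit_left: "((\<lambda>e. e * a) \<longlongrightarrow> a) approx_unit"
proof (rule tendstoI)
  fix \<epsilon> :: real
  assume "\<epsilon> > 0"
  then show "\<forall>\<^sub>F e in approx_unit. dist (e * a) a < \<epsilon>"
  proof (rule eventually_mono[OF eventually_approx_unit[of \<epsilon> "star a"]])
    fix e
    assume e: "sa_contraction e \<and> norm (star a - star a * e) < \<epsilon>"
    then have "star (star a - star a * e) = a - e * a"
      by (simp add: sa_contraction_def star_diff star_mult star_star)
    then show "dist (e * a) a < \<epsilon>"
      using e by (metis dist_commute dist_norm norm_star)
  qed
qed

section \<open>Functionals on a Hilbert bimodule\<close>

text \<open>Evaluating \<open>f\<close>, of norm \<open>N\<close>, at \<open>x + s (y - T e y)\<close> with suitable phases gives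
  \<open>N - s\<^sup>2 + s \<bar>f (y - T e y)\<bar> \<le> N (1 + 3 s\<^sup>2)\<close> when \<open>x\<close> attains \<open>N\<close> up to \<open>s\<^sup>2\<close>, \<open>\<epsilon> = s\<close> and
  \<open>y\<close> is in the unit ball. The map \<open>T\<close> is the left or the right action.\<close>

lemma functional_concentrates:
  fixes f :: "'v::complex_normed_vector cdual" and T :: "'e \<Rightarrow> 'v \<Rightarrow> 'v"
  assumes lin: "\<And>e. clinear (T e)"
    and spread: "\<And>x \<epsilon>. norm x \<le> 1 \<Longrightarrow> \<epsilon> > 0 \<Longrightarrow>
      \<exists>e. P e \<and> (\<forall>y s. norm y \<le> 1 \<longrightarrow> 0 < s \<longrightarrow>
        (norm (x + s *\<^sub>R (y - T e y)))\<^sup>2 \<le> 1 + 2 * s * \<epsilon> + 4 * s\<^sup>2)"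
    and \<eta>: "\<eta> > 0"
  obtains e where "P e" "\<And>y. cmod (cdual_apply f (y - T e y)) \<le> \<eta> * norm y"
proof -
  define N where "N = norm f"
  have N0: "0 \<le> N"
    by (simp add: N_def)
  define s where "s = \<eta> / (1 + 3 * N)"
  have N1: "1 + 3 * N > 0"
    using N0 by simp
  then have "s * (1 + 3 * N) = \<eta>"
    by (simp add: s_def)
  then have s: "s > 0" "s + 3 * N * s = \<eta>"
    using \<eta> N1 by (simp add: s_def, simp add: distrib_left mult.commute)
  obtain x where x: "norm x \<le> 1" "N - s\<^sup>2 \<le> cmod (cdual_apply f x)"
  proof (cases "N - s\<^sup>2 \<le> 0")
    case True
    then show thesis
      by (intro that[of 0] order_trans[OF True norm_ge_zero]) simp
  next
    case False
    have "\<exists>x. cmod (cdual_apply f x) > (N - s\<^sup>2) * norm x"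
    proof (rule ccontr)
      assume "\<not> ?thesis"
      then have "norm f \<le> N - s\<^sup>2"
        using False by (intro norm_cdual_bound) (auto simp: not_less)
      then show False
        using s(1) by (simp add: N_def)
    qed
    then obtain x where x: "cmod (cdual_apply f x) > (N - s\<^sup>2) * norm x" ..
    then have "x \<noteq> 0"
      using cdual_apply_scaleC[of f 0 0] by auto
    let ?c = "complex_of_real (1 / norm x)"
    have "cdual_apply f (?c *\<^sub>C x) = ?c * cdual_apply f x"
      by (simp only: cdual_apply_scaleC scaleC_complex_def)
    then have "cmod (cdual_apply f (?c *\<^sub>C x)) = cmod (cdual_apply f x) / norm x"
      by (simp add: norm_mult norm_divide)
    then have "N - s\<^sup>2 \<le> cmod (cdual_apply f (?c *\<^sub>C x))"
      using x \<open>x \<noteq> 0\<close> by (simp add: pos_le_divide_eq)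
    moreover have "norm (?c *\<^sub>C x) \<le> 1"
      using \<open>x \<noteq> 0\<close> by (simp add: norm_scaleC norm_divide)
    ultimately show thesis
      using that by blast
  qed
  obtain u where u: "cmod u = 1" "u * cdual_apply f x = complex_of_real (cmod (cdual_apply f x))"
    using rotate_to_nonneg by blast
  define x' where "x' = u *\<^sub>C x"
  have "norm x' \<le> 1"
    using x u by (simp add: x'_def norm_scaleC)
  then obtain e where e: "P e" "\<And>y r. norm y \<le> 1 \<Longrightarrow> 0 < r \<Longrightarrow>
        (norm (x' + r *\<^sub>R (y - T e y)))\<^sup>2 \<le> 1 + 2 * r * s + 4 * r\<^sup>2"
    using spread[of x' s] s(1) by blast
  have unit: "cmod (cdual_apply f (y - T e y)) \<le> \<eta>" if y: "norm y \<le> 1" for y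
  proof -
    obtain v where v: "cmod v = 1"
      "v * cdual_apply f (y - T e y) = complex_of_real (cmod (cdual_apply f (y - T e y)))"
      using rotate_to_nonneg by blast
    define m where "m = cmod (cdual_apply f (y - T e y))"
    define z where "z = v *\<^sub>C y - T e (v *\<^sub>C y)"
    have "z = v *\<^sub>C (y - T e y)"
      by (simp add: z_def clinear_scaleC[OF lin] complex_vector.scale_right_diff_distrib)
    then have fz: "cdual_apply f z = m"
      by (simp add: cdual_apply_scaleC scaleC_complex_def v m_def)
    have fx: "cdual_apply f x' = cmod (cdual_apply f x)"
      by (simp add: x'_def cdual_apply_scaleC scaleC_complex_def u)
    have "(norm (x' + s *\<^sub>R z))\<^sup>2 \<le> 1 + 2 * s * s + 4 * s\<^sup>2"
      unfolding z_def using y s(1) by (intro e(2)) (simp_all add: norm_scaleC v)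
    also have "\<dots> \<le> (1 + 3 * s\<^sup>2)\<^sup>2"
      using s(1) by (simp add: power2_eq_square algebra_simps)
    finally have nz: "norm (x' + s *\<^sub>R z) \<le> 1 + 3 * s\<^sup>2"
      by (rule power2_le_imp_le) simp
    have "cdual_apply f (x' + s *\<^sub>R z) = complex_of_real (cmod (cdual_apply f x) + s * m)"
      by (simp add: scaleR_scaleC cdual_apply_add cdual_apply_scaleC scaleC_complex_def fz fx)
    then have "cmod (cdual_apply f x) + s * m \<le> cmod (cdual_apply f (x' + s *\<^sub>R z))"
      using abs_ge_self by (simp only: norm_of_real)
    also have "\<dots> \<le> N * norm (x' + s *\<^sub>R z)"
      unfolding N_def by (rule norm_cdual_apply_le)
    also have "\<dots> \<le> N * (1 + 3 * s\<^sup>2)"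
      by (rule mult_left_mono[OF nz N0])
    finally have "s * m \<le> s\<^sup>2 + 3 * N * s\<^sup>2"
      using x(2) by (simp add: algebra_simps)
    then have "s * m \<le> s * \<eta>"
      by (simp add: power2_eq_square algebra_simps flip: s(2))
    then show ?thesis
      using s(1) by (simp add: m_def)
  qed
  have "cmod (cdual_apply f (y - T e y)) \<le> \<eta> * norm y" for y
  proof (cases "y = 0")
    case True
    then show ?thesis
      using clinear_scaleC[OF lin, of e 0 0] cdual_apply_scaleC[of f 0 0] by simp
  next
    case False
    let ?c = "complex_of_real (1 / norm y)"
    have "cdual_apply f (?c *\<^sub>C y - T e (?c *\<^sub>C y)) = ?c * cdual_apply f (y - T e y)"
      unfolding clinear_scaleC[OF lin] complex_vector.scale_right_diff_distrib[symmetric]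
      by (simp only: cdual_apply_scaleC scaleC_complex_def)
    moreover have "cmod (cdual_apply f (?c *\<^sub>C y - T e (?c *\<^sub>C y))) \<le> \<eta>"
      using False by (intro unit) (simp add: norm_scaleC norm_divide)
    ultimately have "cmod (cdual_apply f (y - T e y)) / norm y \<le> \<eta>"
      by (simp add: norm_mult norm_divide)
    then show ?thesis
      using False by (simp add: pos_divide_le_eq)
  qed
  then show thesis
    using that e(1) by blast
qed

lemma sa_contractionD: "sa_contraction e \<Longrightarrow> star e = e" "sa_contraction e \<Longrightarrow> norm e \<le> 1"
  by (simp_all add: sa_contraction_def)

lemma clinear_diff: "clinear f \<Longrightarrow> f (x - y) = f x - f y"
  using clinear_add[of f "x - y" y] by simp

context hilbert_bimodule
begin

lemma clinear_lact: "clinear (lact a)" "clinear (\<lambda>a. lact a x)"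
  and clinear_ract: "clinear (\<lambda>x. ract x b)" "clinear (ract x)"
  using cbilinear_lact cbilinear_ract by (auto simp: cbilinear_def)

lemma lip_lact_right: "lip x (lact a y) = lip x y * star a"
  by (metis lip_lact star_lip star_mult)

lemma rip_ract_left: "rip (ract x b) y = star b * rip x y"
  by (metis rip_ract star_rip star_mult)

lemma lip_add_right: "lip x (y + z) = lip x y + lip x z"
  using clinear_add[OF clinear_lip, of y z x] by (metis star_add star_lip)

lemma rip_add_left: "rip (x + y) z = rip x z + rip y z"
  using clinear_add[OF clinear_rip, of z x y] by (metis star_add star_rip)

lemma lip_diff_right: "lip x (y - z) = lip x y - lip x z"
  using lip_add_right[of x "y - z" z] by simp

lemma rip_diff_left: "rip (x - y) z = rip x z - rip y z"
  using rip_add_left[of "x - y" y z] by simp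

lemmas lip_diff_left = clinear_diff[OF clinear_lip]
lemmas rip_diff_right = clinear_diff[OF clinear_rip]

text \<open>The axiom relating the two inner products makes both sides act equally on the right of every
  \<open>z\<close>. Their difference \<open>d\<close> therefore annihilates all inner products, in particular those whose
  difference is \<open>d\<^sup>*\<close>, so \<open>d\<^sup>* d = 0\<close>.\<close>

lemma rip_lact: "rip x (lact a y) = rip (lact (star a) x) y"
proof -
  define d where "d = rip x (lact a y) - rip (lact (star a) x) y"
  have "ract z d = 0" for z
  proof -
    have "ract z (rip x (lact a y)) = lact (lip z x * a) y"
      by (simp add: lact_lact flip: lip_rip)
    moreover have "ract z (rip (lact (star a) x) y) = lact (lip z x * a) y"
      by (simp add: lip_lact_right star_star flip: lip_rip)
    ultimately show ?thesis
      by (simp add: d_def clinear_diff[OF clinear_ract(2)])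
  qed
  then have "rip w z * d = 0" for w z
    using rip_ract[of w z d] rip_diff_right[of w 0 0] by simp
  then have "star d * star (star d) = 0"
    by (simp add: star_star) (simp add: d_def star_diff star_rip left_diff_distrib)
  then have "star d = 0"
    by (rule self_star_mult_eq_0)
  then have "d = 0"
    using norm_star[of d] by simp
  then show ?thesis
    by (simp add: d_def)
qed

lemma lip_ract: "lip (ract x b) y = lip x (ract y (star b))"
proof -
  define d where "d = lip (ract x b) y - lip x (ract y (star b))"
  have "lact d z = 0" for z
    by (simp add: d_def clinear_diff[OF clinear_lact(2)] lip_rip ract_ract rip_ract_left star_star)
  then have "d * lip z w = 0" for w z
    using lip_lact[of d z w] lip_diff_left[of 0 0 w] by simp
  then have "d * star d = 0"
    by (subst (2) d_def) (simp add: star_diff star_lip right_diff_distrib)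
  then have "d = 0"
    by (rule self_star_mult_eq_0)
  then show ?thesis
    by (simp add: d_def)
qed

lemma norm_rip_power2: "norm (rip x x) = (norm x)\<^sup>2"
  by (simp add: norm_rip[of x])

lemma norm_lip_power2: "norm (lip x x) = (norm x)\<^sup>2"
  by (simp add: norm_lip[of x])

text \<open>The Cauchy--Schwarz inequality. Writing \<open>\<langle>x, x\<rangle>\<^sub>A = b\<^sup>* b\<close>, adjointability gives
  \<open>\<langle>x, y\<rangle>\<^sub>B\<^sup>* \<langle>x, y\<rangle>\<^sub>B = \<langle>b y, b y\<rangle>\<^sub>B\<close>.\<close>

lemma norm_rip_le: "norm (rip x y) \<le> norm x * norm y"
proof -
  obtain b where b: "lip x x = star b * b"
    using lip_positive by (auto simp: cstar_positive_def)
  have nb: "norm b = norm x"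
    using norm_lip_power2[of x] by (simp add: b norm_star_mult)
  have "star (rip x y) * rip x y = rip y (lact (lip x x) y)"
    by (simp add: star_rip rip_ract lip_rip)
  also have "\<dots> = rip (lact b y) (lact b y)"
    by (simp add: b rip_lact[of y "star b"] star_star flip: lact_lact)
  finally have "(norm (rip x y))\<^sup>2 = (norm (lact b y))\<^sup>2"
    by (simp add: norm_rip_power2 flip: norm_star_mult)
  then have "norm (rip x y) = norm (lact b y)"
    by simp
  then show ?thesis
    using norm_lact_le[of b y] by (simp add: nb)
qed

lemma norm_lip_le: "norm (lip x y) \<le> norm x * norm y"
proof -
  obtain b where b: "rip y y = star b * b"
    using rip_positive by (auto simp: cstar_positive_def)
  have nb: "norm b = norm y"
    using norm_rip_power2[of y] by (simp add: b norm_star_mult)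
  have "star (star (lip x y)) * star (lip x y) = lip (ract x (rip y y)) x"
    by (simp add: star_lip lip_rip flip: lip_lact)
  also have "\<dots> = lip (ract x (star b)) (ract x (star b))"
    by (simp add: b lip_ract[of _ b] flip: ract_ract)
  finally have "(norm (star (lip x y)))\<^sup>2 = (norm (ract x (star b)))\<^sup>2"
    by (simp add: norm_lip_power2 flip: norm_star_mult)
  then have "norm (lip x y) = norm (ract x (star b))"
    by (simp add: norm_star)
  then show ?thesis
    using norm_ract_le[of x "star b"] by (simp add: nb norm_star)
qed

lemma lact_approx:
  assumes "\<epsilon> > 0"
  obtains e where "sa_contraction e" "norm (x - lact e x) < \<epsilon>"
proof -
  define h where "h = lip x x"
  obtain e where e: "sa_contraction e" "norm (h - h * e) < \<epsilon>\<^sup>2 / 2"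
    using sa_contraction_approx[of h "\<epsilon>\<^sup>2 / 2"] assms by (auto simp: h_def star_lip)
  have "lip (x - lact e x) (x - lact e x) = (h - h * e) - e * (h - h * e)"
    by (simp add: h_def lip_diff_left lip_diff_right lip_lact lip_lact_right
        sa_contractionD[OF e(1)] algebra_simps)
  then have "(norm (x - lact e x))\<^sup>2 = norm ((h - h * e) - e * (h - h * e))"
    by (simp flip: norm_lip_power2)
  also have "\<dots> < \<epsilon>\<^sup>2"
    using norm_compress_le(1)[OF e(1), of "h - h * e"] e(2) by simp
  finally have "norm (x - lact e x) < \<epsilon>"
    using assms power_less_imp_less_base[of _ 2 \<epsilon>] by force
  then show thesis
    using that e(1) by blast
qed

lemma ract_approx:
  assumes "\<epsilon> > 0"
  obtains e where "sa_contraction e" "norm (x - ract x e) < \<epsilon>"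
proof -
  define h where "h = rip x x"
  obtain e where e: "sa_contraction e" "norm (h - h * e) < \<epsilon>\<^sup>2 / 2"
    using sa_contraction_approx[of h "\<epsilon>\<^sup>2 / 2"] assms by (auto simp: h_def star_rip)
  have "rip (x - ract x e) (x - ract x e) = (h - h * e) - e * (h - h * e)"
    by (simp add: h_def rip_diff_left rip_diff_right rip_ract rip_ract_left
        sa_contractionD[OF e(1)] algebra_simps)
  then have "(norm (x - ract x e))\<^sup>2 = norm ((h - h * e) - e * (h - h * e))"
    by (simp flip: norm_rip_power2)
  also have "\<dots> < \<epsilon>\<^sup>2"
    using norm_compress_le(1)[OF e(1), of "h - h * e"] e(2) by simp
  finally have "norm (x - ract x e) < \<epsilon>"
    using assms power_less_imp_less_base[of _ 2 \<epsilon>] by force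
  then show thesis
    using that e(1) by blast
qed

lemma norm_add_le_rip:
  assumes "norm x \<le> 1" "norm z \<le> 2" "norm (rip x z) \<le> \<epsilon>" "0 < s"
  shows "(norm (x + s *\<^sub>R z))\<^sup>2 \<le> 1 + 2 * s * \<epsilon> + 4 * s\<^sup>2"
proof -
  have sc: "rip w (s *\<^sub>R v) = s *\<^sub>R rip w v" "rip (s *\<^sub>R v) w = s *\<^sub>R rip v w" for v w
  proof -
    show *: "rip w (s *\<^sub>R v) = s *\<^sub>R rip w v" for v w
      by (simp add: scaleR_scaleC clinear_scaleC[OF clinear_rip])
    show "rip (s *\<^sub>R v) w = s *\<^sub>R rip v w"
      using *[of w v] by (metis star_rip star_scaleR)
  qed
  have "rip (x + s *\<^sub>R z) (x + s *\<^sub>R z) =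
      (rip x x + s *\<^sub>R rip x z) + (s *\<^sub>R rip z x + (s * s) *\<^sub>R rip z z)"
    by (simp add: clinear_add[OF clinear_rip] rip_add_left sc scaleR_add_right)
  also have "norm \<dots> \<le>
      (norm (rip x x) + norm (s *\<^sub>R rip x z)) + (norm (s *\<^sub>R rip z x) + norm ((s * s) *\<^sub>R rip z z))"
    by (intro order_trans[OF norm_triangle_ineq] add_mono norm_triangle_ineq)
  also have "\<dots> = (norm x)\<^sup>2 + 2 * s * norm (rip x z) + s\<^sup>2 * (norm z)\<^sup>2"
    using assms(4) norm_star[of "rip x z"]
    by (simp add: norm_rip_power2 star_rip power2_eq_square)
  also have "\<dots> \<le> 1 + 2 * s * \<epsilon> + s\<^sup>2 * 2\<^sup>2"
    using assms by (intro add_mono mult_left_mono power_mono power_le_one) simp_all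
  finally show ?thesis
    by (simp add: norm_rip_power2)
qed

lemma norm_add_le_lip:
  assumes "norm x \<le> 1" "norm z \<le> 2" "norm (lip x z) \<le> \<epsilon>" "0 < s"
  shows "(norm (x + s *\<^sub>R z))\<^sup>2 \<le> 1 + 2 * s * \<epsilon> + 4 * s\<^sup>2"
proof -
  have sc: "lip w (s *\<^sub>R v) = s *\<^sub>R lip w v" "lip (s *\<^sub>R v) w = s *\<^sub>R lip v w" for v w
  proof -
    show *: "lip (s *\<^sub>R v) w = s *\<^sub>R lip v w" for v w
      by (simp add: scaleR_scaleC clinear_scaleC[OF clinear_lip])
    show "lip w (s *\<^sub>R v) = s *\<^sub>R lip w v"
      using *[of v w] by (metis star_lip star_scaleR)
  qed
  have "lip (x + s *\<^sub>R z) (x + s *\<^sub>R z) =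
      (lip x x + s *\<^sub>R lip x z) + (s *\<^sub>R lip z x + (s * s) *\<^sub>R lip z z)"
    by (simp add: clinear_add[OF clinear_lip] lip_add_right sc scaleR_add_right)
  also have "norm \<dots> \<le>
      (norm (lip x x) + norm (s *\<^sub>R lip x z)) + (norm (s *\<^sub>R lip z x) + norm ((s * s) *\<^sub>R lip z z))"
    by (intro order_trans[OF norm_triangle_ineq] add_mono norm_triangle_ineq)
  also have "\<dots> = (norm x)\<^sup>2 + 2 * s * norm (lip x z) + s\<^sup>2 * (norm z)\<^sup>2"
    using assms(4) norm_star[of "lip x z"]
    by (simp add: norm_lip_power2 star_lip power2_eq_square)
  also have "\<dots> \<le> 1 + 2 * s * \<epsilon> + s\<^sup>2 * 2\<^sup>2"
    using assms by (intro add_mono mult_left_mono power_mono power_le_one) simp_all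
  finally show ?thesis
    by (simp add: norm_lip_power2)
qed

lemma norm_lact_contraction: "norm e \<le> 1 \<Longrightarrow> norm (lact e y) \<le> norm y"
  using norm_lact_le[of e y] mult_right_mono[of "norm e" 1 "norm y"] by simp

lemma norm_ract_contraction: "norm e \<le> 1 \<Longrightarrow> norm (ract y e) \<le> norm y"
  using norm_ract_le[of y e] mult_left_mono[of "norm e" 1 "norm y"] by simp

lemma functional_lact_approx:
  assumes "\<eta> > 0"
  obtains e where "sa_contraction e"
    "\<And>y. cmod (cdual_apply f (y - lact e y)) \<le> \<eta> * norm y"
proof (rule functional_concentrates[of lact sa_contraction \<eta> f, OF clinear_lact(1) _ assms])
  fix x :: 'v and \<epsilon> :: real
  assume x: "norm x \<le> 1" and "\<epsilon> > 0"
  obtain e where e: "sa_contraction e" "norm (x - lact e x) < \<epsilon>"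
    using lact_approx[OF \<open>\<epsilon> > 0\<close>] .
  have "(norm (x + s *\<^sub>R (y - lact e y)))\<^sup>2 \<le> 1 + 2 * s * \<epsilon> + 4 * s\<^sup>2"
    if y: "norm y \<le> 1" and s: "0 < s" for y s
  proof (rule norm_add_le_rip[OF x _ _ s])
    show "norm (y - lact e y) \<le> 2"
      using norm_triangle_ineq4[of y "lact e y"] y
        norm_lact_contraction[OF sa_contractionD(2)[OF e(1)], of y] by simp
    have "rip x (y - lact e y) = rip (x - lact e x) y"
      by (simp add: rip_diff_left rip_diff_right rip_lact sa_contractionD(1)[OF e(1)])
    moreover have "norm (rip (x - lact e x) y) \<le> norm (x - lact e x) * 1"
      using y by (intro order_trans[OF norm_rip_le] mult_left_mono) simp_all
    ultimately show "norm (rip x (y - lact e y)) \<le> \<epsilon>"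
      using e(2) by simp
  qed
  then show "\<exists>e. sa_contraction e \<and> (\<forall>y s. norm y \<le> 1 \<longrightarrow> 0 < s \<longrightarrow>
      (norm (x + s *\<^sub>R (y - lact e y)))\<^sup>2 \<le> 1 + 2 * s * \<epsilon> + 4 * s\<^sup>2)"
    using e(1) by blast
qed (rule that)

lemma functional_ract_approx:
  assumes "\<eta> > 0"
  obtains e where "sa_contraction e"
    "\<And>y. cmod (cdual_apply f (y - ract y e)) \<le> \<eta> * norm y"
proof (rule functional_concentrates[of "\<lambda>e x. ract x e" sa_contraction \<eta> f,
      OF clinear_ract(1) _ assms])
  fix x :: 'v and \<epsilon> :: real
  assume x: "norm x \<le> 1" and "\<epsilon> > 0"
  obtain e where e: "sa_contraction e" "norm (x - ract x e) < \<epsilon>"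
    using ract_approx[OF \<open>\<epsilon> > 0\<close>] .
  have "(norm (x + s *\<^sub>R (y - ract y e)))\<^sup>2 \<le> 1 + 2 * s * \<epsilon> + 4 * s\<^sup>2"
    if y: "norm y \<le> 1" and s: "0 < s" for y s
  proof (rule norm_add_le_lip[OF x _ _ s])
    show "norm (y - ract y e) \<le> 2"
      using norm_triangle_ineq4[of y "ract y e"] y
        norm_ract_contraction[OF sa_contractionD(2)[OF e(1)], of y] by simp
    have "lip x (y - ract y e) = lip (x - ract x e) y"
      by (simp add: lip_diff_left lip_diff_right lip_ract sa_contractionD(1)[OF e(1)])
    moreover have "norm (lip (x - ract x e) y) \<le> norm (x - ract x e) * 1"
      using y by (intro order_trans[OF norm_lip_le] mult_left_mono) simp_all
    ultimately show "norm (lip x (y - ract y e)) \<le> \<epsilon>"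
      using e(2) by simp
  qed
  then show "\<exists>e. sa_contraction e \<and> (\<forall>y s. norm y \<le> 1 \<longrightarrow> 0 < s \<longrightarrow>
      (norm (x + s *\<^sub>R (y - ract y e)))\<^sup>2 \<le> 1 + 2 * s * \<epsilon> + 4 * s\<^sup>2)"
    using e(1) by blast
qed (rule that)

lemma dual_act_approx:
  assumes "\<eta> > 0"
  obtains a b where "norm a \<le> 1" "norm b \<le> 1" "norm (f - dual_act lact ract a b f) \<le> \<eta>"
proof -
  have \<eta>2: "\<eta> / 2 > 0"
    using assms by simp
  obtain a where a: "sa_contraction a"
    "\<And>y. cmod (cdual_apply f (y - lact a y)) \<le> \<eta> / 2 * norm y"
    using functional_lact_approx[OF \<eta>2] by blast
  obtain b where b: "sa_contraction b"
    "\<And>y. cmod (cdual_apply f (y - ract y b)) \<le> \<eta> / 2 * norm y"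
    using functional_ract_approx[OF \<eta>2] by blast
  have "cmod (cdual_apply (f - dual_act lact ract a b f) y) \<le> \<eta> * norm y" for y
  proof -
    have "cdual_apply (f - dual_act lact ract a b f) y
        = cdual_apply f (y - lact a y) + cdual_apply f (lact a y - ract (lact a y) b)"
      by (simp add: minus_cdual.rep_eq dual_act_apply clinear_diff[OF clinear_cdual_apply])
    also have "cmod \<dots> \<le> \<eta> / 2 * norm y + \<eta> / 2 * norm (lact a y)"
      by (intro order_trans[OF norm_triangle_ineq] add_mono a b)
    also have "\<dots> \<le> \<eta> / 2 * norm y + \<eta> / 2 * norm y"
      using norm_lact_contraction[OF sa_contractionD(2)[OF a(1)], of y] assms
      by (intro add_left_mono mult_left_mono) simp_all
    finally show ?thesis
      by simp
  qed
  then have "norm (f - dual_act lact ract a b f) \<le> \<eta>"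
    using assms by (intro norm_cdual_bound) simp_all
  then show thesis
    using that sa_contractionD(2)[OF a(1)] sa_contractionD(2)[OF b(1)] by blast
qed

end

section \<open>Quasi-multipliers\<close>

lemma qm_norm_le:
  assumes "\<And>a b. norm a \<le> 1 \<Longrightarrow> norm b \<le> 1 \<Longrightarrow> norm (q a b) \<le> K"
  shows "qm_norm q \<le> K"
  unfolding qm_norm_def
proof (rule cSup_least)
  have "norm (q 0 0) \<in> {norm (q a b) |a b. norm a \<le> 1 \<and> norm b \<le> 1}"
    by (intro CollectI exI[of _ 0]) simp
  then show "{norm (q a b) |a b. norm a \<le> 1 \<and> norm b \<le> 1} \<noteq> {}"
    by blast
qed (use assms in auto)

lemma norm_le_qm_norm:
  assumes q: "bounded_bilinear q" and ab: "norm a \<le> 1" "norm b \<le> 1"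
  shows "norm (q a b) \<le> qm_norm q"
  unfolding qm_norm_def
proof (rule cSup_upper)
  obtain K where K: "0 < K" "\<And>a b. norm (q a b) \<le> norm a * norm b * K"
    using bounded_bilinear.pos_bounded[OF q] by blast
  have "norm (q a b) \<le> K" if "norm a \<le> 1" "norm b \<le> 1" for a b
  proof -
    have "norm a * norm b * K \<le> 1 * 1 * K"
      using that K(1) by (intro mult_mono) simp_all
    then show ?thesis
      using K(2)[of a b] by simp
  qed
  then show "bdd_above {norm (q a b) |a b. norm a \<le> 1 \<and> norm b \<le> 1}"
    by (intro bdd_aboveI[of _ K]) auto
qed (use ab in auto)

lemma filter_limit_exists:
  fixes h :: "'p \<Rightarrow> 'm::complete_space"
  assumes F: "F \<noteq> bot"
    and near: "\<And>\<eta>. \<eta> > 0 \<Longrightarrow> \<exists>c. \<forall>\<^sub>F p in F. dist (h p) c < \<eta>"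
  shows "\<exists>L. (h \<longlongrightarrow> L) F"
proof -
  have "\<exists>c. \<forall>n. \<forall>\<^sub>F p in F. dist (h p) (c n) < 1 / real (Suc n)"
    by (intro choice allI near) simp
  then obtain c where c: "\<And>n. \<forall>\<^sub>F p in F. dist (h p) (c n) < 1 / real (Suc n)"
    by blast
  have cc: "dist (c m) (c n) < 1 / real (Suc m) + 1 / real (Suc n)" for m n
  proof -
    have "\<forall>\<^sub>F p in F. dist (h p) (c m) < 1 / real (Suc m) \<and> dist (h p) (c n) < 1 / real (Suc n)"
      by (intro eventually_conj c)
    then obtain p where "dist (h p) (c m) < 1 / real (Suc m)" "dist (h p) (c n) < 1 / real (Suc n)"
      using eventually_happens'[OF F] by blast
    then show ?thesis
      using dist_triangle3[of "c m" "c n" "h p"] by linarith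
  qed
  have small: "\<exists>N. \<forall>n\<ge>N. 1 / real (Suc n) < \<epsilon>" if \<epsilon>: "\<epsilon> > 0" for \<epsilon>
    using order_tendstoD(2)[OF LIMSEQ_Suc[OF lim_1_over_n] \<epsilon>]
    by (simp add: eventually_sequentially)
  have "Cauchy c"
  proof (rule metric_CauchyI)
    fix \<epsilon> :: real
    assume "\<epsilon> > 0"
    then obtain N where "\<forall>n\<ge>N. 1 / real (Suc n) < \<epsilon> / 2"
      using small[of "\<epsilon> / 2"] by auto
    then show "\<exists>N. \<forall>m\<ge>N. \<forall>n\<ge>N. dist (c m) (c n) < \<epsilon>"
      using cc by (intro exI[of _ N] allI impI) (smt (verit) field_sum_of_halves)
  qed
  then obtain L where L: "c \<longlonglongrightarrow> L"
    using Cauchy_convergent convergent_def by blast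
  have "(h \<longlongrightarrow> L) F"
  proof (rule tendstoI)
    fix \<epsilon> :: real
    assume \<epsilon>: "\<epsilon> > 0"
    then obtain N where N: "\<forall>n\<ge>N. 1 / real (Suc n) < \<epsilon> / 2"
      using small[of "\<epsilon> / 2"] by auto
    obtain M where M: "\<forall>n\<ge>M. dist (c n) L < \<epsilon> / 2"
      using metric_LIMSEQ_D[OF L, of "\<epsilon> / 2"] \<epsilon> by auto
    define n where "n = max M N"
    have n: "1 / real (Suc n) < \<epsilon> / 2" "dist (c n) L < \<epsilon> / 2"
      using N M by (auto simp: n_def)
    show "\<forall>\<^sub>F p in F. dist (h p) L < \<epsilon>"
      using c[of n]
    proof eventually_elim
      case (elim p)
      then show ?case
        using n dist_triangle[of "h p" L "c n"] by linarith
    qed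
  qed
  then show ?thesis ..
qed

context hilbert_bimodule
begin

abbreviation bact :: "'a \<Rightarrow> 'v cdual cdual \<Rightarrow> 'b \<Rightarrow> 'v cdual cdual"
  where "bact \<equiv> bidual_act lact ract"

abbreviation BQ :: "'v cdual cdual set"
  where "BQ \<equiv> bidual_quasi_multipliers lact ract"

abbreviation qof :: "'v cdual cdual \<Rightarrow> 'a \<Rightarrow> 'b \<Rightarrow> 'v"
  where "qof \<equiv> quasi_multiplier_of lact ract"

lemma quasi_multiplier_of_unique: "bidual_embed x = bact a t b \<Longrightarrow> qof t a b = x"
  unfolding quasi_multiplier_of_def
  by (rule the_equality) (auto intro: iffD1[OF bidual_embed_eq_iff])

lemma bidual_embed_quasi_multiplier_of: "t \<in> BQ \<Longrightarrow> bidual_embed (qof t a b) = bact a t b"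
proof -
  assume "t \<in> BQ"
  then obtain x where "bidual_embed x = bact a t b"
    by (auto simp: bidual_quasi_multipliers_def image_iff) metis
  then show ?thesis
    by (simp add: quasi_multiplier_of_unique)
qed

lemma bact_add: "bact a (s + t) b = bact a s b + bact a t b"
  by (rule cdual_eqI) (simp add: bidual_act_apply plus_cdual.rep_eq)

lemma bact_scaleC: "bact a (c *\<^sub>C t) b = c *\<^sub>C bact a t b"
  by (rule cdual_eqI) (simp add: bidual_act_apply scaleC_cdual.rep_eq)

lemma in_BQ: "(\<And>a b. bidual_embed (q a b) = bact a t b) \<Longrightarrow> t \<in> BQ"
  unfolding bidual_quasi_multipliers_def by (auto intro: range_eqI[OF sym])

lemma BQ_add:
  assumes "s \<in> BQ" "t \<in> BQ"
  shows "s + t \<in> BQ" "qof (s + t) a b = qof s a b + qof t a b"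
proof -
  have *: "bidual_embed (qof s a b + qof t a b) = bact a (s + t) b" for a b
    using assms by (simp add: bact_add bidual_embed_add bidual_embed_quasi_multiplier_of)
  show "s + t \<in> BQ"
    by (rule in_BQ[OF *])
  show "qof (s + t) a b = qof s a b + qof t a b"
    by (rule quasi_multiplier_of_unique[OF *])
qed

lemma BQ_scaleC:
  assumes "t \<in> BQ"
  shows "c *\<^sub>C t \<in> BQ" "qof (c *\<^sub>C t) a b = c *\<^sub>C qof t a b"
proof -
  have *: "bidual_embed (c *\<^sub>C qof t a b) = bact a (c *\<^sub>C t) b" for a b
    using assms by (simp add: bact_scaleC bidual_embed_scaleC bidual_embed_quasi_multiplier_of)
  show "c *\<^sub>C t \<in> BQ"
    by (rule in_BQ[OF *])
  show "qof (c *\<^sub>C t) a b = c *\<^sub>C qof t a b"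
    by (rule quasi_multiplier_of_unique[OF *])
qed

lemma csubspace_BQ: "csubspace BQ"
proof (rule complex_vector.subspaceI)
  have "bidual_embed (0 :: 'v) = bact a 0 b" for a b
    by (rule cdual_eqI) (simp add: bidual_act_apply bidual_embed_apply zero_cdual.rep_eq
        cdual_apply_scaleC[of _ 0 0, simplified])
  then show "0 \<in> BQ"
    by (rule in_BQ)
qed (simp_all add: BQ_add BQ_scaleC)

lemma dual_act_bilinear:
  "dual_act lact ract (a + a') b f = dual_act lact ract a b f + dual_act lact ract a' b f"
  "dual_act lact ract a (b + b') f = dual_act lact ract a b f + dual_act lact ract a b' f"
  "dual_act lact ract (c *\<^sub>C a) b f = c *\<^sub>C dual_act lact ract a b f"
  "dual_act lact ract a (c *\<^sub>C b) f = c *\<^sub>C dual_act lact ract a b f"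
  by (rule cdual_eqI; simp add: dual_act_apply plus_cdual.rep_eq scaleC_cdual.rep_eq
      clinear_add[OF clinear_lact(2)] clinear_add[OF clinear_ract(1)]
      clinear_add[OF clinear_ract(2)] clinear_scaleC[OF clinear_lact(2)]
      clinear_scaleC[OF clinear_ract(1)] clinear_scaleC[OF clinear_ract(2)]
      cdual_apply_add cdual_apply_scaleC scaleC_complex_def)+

lemma dual_act_mult:
  "dual_act lact ract (c * a) (b * d) f = dual_act lact ract a b (dual_act lact ract c d f)"
  by (rule cdual_eqI) (simp add: dual_act_apply ract_lact flip: ract_ract lact_lact)

lemma norm_dual_act_le: "norm (dual_act lact ract a b f) \<le> norm a * norm b * norm f"
  by (rule norm_cdual_bound) (simp_all add: dual_act_apply cmod_dual_act_le)

lemma norm_bact_le: "norm (bact a t b) \<le> norm a * norm b * norm t"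
proof (rule norm_cdual_bound)
  fix f
  have "norm t * norm (dual_act lact ract a b f) \<le> norm t * (norm a * norm b * norm f)"
    by (intro mult_left_mono norm_dual_act_le) simp
  then show "cmod (cdual_apply (bact a t b) f) \<le> norm a * norm b * norm t * norm f"
    using norm_cdual_apply_le[of t "dual_act lact ract a b f"]
    by (simp add: bidual_act_apply mult_ac)
qed simp

lemma bact_bilinear:
  "bact (a + a') t b = bact a t b + bact a' t b"
  "bact a t (b + b') = bact a t b + bact a t b'"
  "bact (c *\<^sub>C a) t b = c *\<^sub>C bact a t b"
  "bact a t (c *\<^sub>C b) = c *\<^sub>C bact a t b"
  by (rule cdual_eqI; simp add: bidual_act_apply dual_act_bilinear plus_cdual.rep_eq
      scaleC_cdual.rep_eq cdual_apply_add cdual_apply_scaleC scaleC_complex_def)+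

lemma norm_quasi_multiplier_of_le:
  "t \<in> BQ \<Longrightarrow> norm (qof t a b) \<le> norm a * norm b * norm t"
  using norm_bact_le[of a t b] norm_bidual_embed[of "qof t a b"]
  by (simp add: bidual_embed_quasi_multiplier_of)

lemma quasi_multiplier_of_in:
  assumes t: "t \<in> BQ"
  shows "qof t \<in> quasi_multipliers lact ract"
proof -
  note e = bidual_embed_quasi_multiplier_of[OF t]
  have bil: "qof t (a + a') b = qof t a b + qof t a' b"
    "qof t a (b + b') = qof t a b + qof t a b'"
    "qof t (c *\<^sub>C a) b = c *\<^sub>C qof t a b"
    "qof t a (c *\<^sub>C b) = c *\<^sub>C qof t a b" for a a' b b' c
    by (rule quasi_multiplier_of_unique;
        simp add: bidual_embed_add bidual_embed_scaleC e bact_bilinear)+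
  have "bounded_bilinear (qof t)"
    using norm_quasi_multiplier_of_le[OF t]
    by unfold_locales (auto simp: bil scaleR_scaleC)
  moreover have "cbilinear (qof t)"
    unfolding cbilinear_def by (auto intro!: clinearI simp: bil)
  moreover have "qof t (c * a) (b * d) = ract (lact c (qof t a b)) d" for a b c d
  proof (rule quasi_multiplier_of_unique, rule cdual_eqI)
    fix f
    have "cdual_apply (bact (c * a) t (b * d)) f = cdual_apply (bact a t b) (dual_act lact ract c d f)"
      by (simp add: bidual_act_apply dual_act_mult)
    then show "cdual_apply (bidual_embed (ract (lact c (qof t a b)) d)) f
        = cdual_apply (bact (c * a) t (b * d)) f"
      by (simp add: bidual_embed_apply dual_act_apply flip: e)
  qed
  ultimately show ?thesis
    by (simp add: quasi_multipliers_def)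
qed

lemma qm_norm_quasi_multiplier_of:
  assumes t: "t \<in> BQ"
  shows "qm_norm (qof t) = norm t"
proof (rule antisym)
  show "qm_norm (qof t) \<le> norm t"
  proof (rule qm_norm_le)
    fix a :: 'a and b :: 'b
    assume "norm a \<le> 1" "norm b \<le> 1"
    then have "norm a * norm b * norm t \<le> 1 * 1 * norm t"
      by (intro mult_mono) simp_all
    then show "norm (qof t a b) \<le> norm t"
      using norm_quasi_multiplier_of_le[OF t, of a b] by simp
  qed
  have bb: "bounded_bilinear (qof t)"
    using quasi_multiplier_of_in[OF t] by (simp add: quasi_multipliers_def)
  show "norm t \<le> qm_norm (qof t)"
  proof (rule norm_cdual_bound)
    show "0 \<le> qm_norm (qof t)"
      using norm_le_qm_norm[OF bb, of 0 0] by (auto intro: order_trans[OF norm_ge_zero])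
    fix f
    show "cmod (cdual_apply t f) \<le> qm_norm (qof t) * norm f"
    proof (rule field_le_epsilon)
      fix \<epsilon> :: real
      assume \<epsilon>: "\<epsilon> > 0"
      define \<eta> where "\<eta> = \<epsilon> / (norm t + 1)"
      have "norm t + 1 > 0"
        by (simp add: add_nonneg_pos)
      then have \<eta>: "\<eta> > 0" "norm t * \<eta> \<le> \<epsilon>"
        using \<epsilon> by (simp_all add: \<eta>_def field_simps)
      obtain a b where ab: "norm a \<le> 1" "norm b \<le> 1"
        "norm (f - dual_act lact ract a b f) \<le> \<eta>"
        using dual_act_approx[OF \<eta>(1)] by blast
      have "cdual_apply t f
          = cdual_apply t (f - dual_act lact ract a b f) + cdual_apply f (qof t a b)"
      proof -
        have "cdual_apply f (qof t a b) = cdual_apply t (dual_act lact ract a b f)"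
          unfolding bidual_act_apply[symmetric] bidual_embed_quasi_multiplier_of[OF t, symmetric]
          by (rule bidual_embed_apply[symmetric])
        then show ?thesis
          by (simp add: clinear_diff[OF clinear_cdual_apply])
      qed
      also have "cmod \<dots> \<le> norm t * norm (f - dual_act lact ract a b f)
          + norm f * norm (qof t a b)"
        by (intro order_trans[OF norm_triangle_ineq] add_mono norm_cdual_apply_le)
      also have "\<dots> \<le> norm t * \<eta> + norm f * qm_norm (qof t)"
        using ab by (intro add_mono mult_left_mono norm_le_qm_norm[OF bb]) simp_all
      finally show "cmod (cdual_apply t f) \<le> qm_norm (qof t) * norm f + \<epsilon>"
        using \<eta>(2) by (simp add: mult.commute)
    qed
  qed
qed

text \<open>Given \<open>q\<close>, the preimage is the weak* limit of \<open>q(e, u)\<close> along approximate units \<open>e\<close>, \<open>u\<close>.\<close>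

lemma quasi_multiplier_of_surj:
  assumes "q \<in> quasi_multipliers lact ract"
  obtains t where "t \<in> BQ" "qof t = q"
proof -
  have q: "bounded_bilinear q"
    and q_mult: "\<And>c a b d. q (c * a) (b * d) = ract (lact c (q a b)) d"
    using assms by (simp_all add: quasi_multipliers_def)
  define F :: "('a \<times> 'b) filter" where "F = approx_unit \<times>\<^sub>F approx_unit"
  have F: "F \<noteq> bot"
    by (simp add: F_def prod_filter_eq_bot approx_unit_neq_bot)
  obtain K where K: "0 < K" "\<And>a b. norm (q a b) \<le> norm a * norm b * K"
    using bounded_bilinear.pos_bounded[OF q] by blast
  have contr: "\<forall>\<^sub>F p in F. norm (q (fst p) (snd p)) \<le> K"
  proof -
    have "\<forall>\<^sub>F p in F. sa_contraction (fst p) \<and> sa_contraction (snd p)"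
      unfolding F_def
      by (rule eventually_prodI[OF eventually_approx_unit_sa_contraction
            eventually_approx_unit_sa_contraction, THEN eventually_mono]) simp
    then show ?thesis
    proof eventually_elim
      case (elim p)
      then have "norm (fst p) * norm (snd p) * K \<le> 1 * 1 * K"
        using K(1) by (intro mult_mono) (simp_all add: sa_contraction_def)
      then show ?case
        using K(2)[of "fst p" "snd p"] by simp
    qed
  qed
  have lim_act: "((\<lambda>p. cdual_apply (dual_act lact ract a b f) (q (fst p) (snd p)))
      \<longlongrightarrow> cdual_apply f (q a b)) F" for a b f
  proof -
    have "filterlim fst approx_unit F" "filterlim snd approx_unit F"
      by (simp_all add: F_def filterlim_fst filterlim_snd)
    then have "((\<lambda>p. a * fst p) \<longlongrightarrow> a) F" "((\<lambda>p. snd p * b) \<longlongrightarrow> b) F"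
      by (auto intro: filterlim_compose[OF tendsto_approx_unit_right]
          filterlim_compose[OF tendsto_approx_unit_left])
    then have "((\<lambda>p. cdual_apply f (q (a * fst p) (snd p * b))) \<longlongrightarrow> cdual_apply f (q a b)) F"
      by (intro bounded_linear.tendsto[OF bounded_linear_cdual_apply]
          bounded_bilinear.tendsto[OF q])
    then show ?thesis
      by (simp add: dual_act_apply q_mult)
  qed
  have "\<exists>L. ((\<lambda>p. cdual_apply f (q (fst p) (snd p))) \<longlongrightarrow> L) F" for f
  proof (rule filter_limit_exists[OF F])
    fix \<eta> :: real
    assume \<eta>: "\<eta> > 0"
    then have "\<eta> / (2 * K) > 0"
      using K(1) by simp
    \<comment> \<open>Replacing \<open>f\<close> by \<open>f(a \<cdot> b)\<close> changes the values at the bounded family \<open>q(e, u)\<close> by at most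
      \<open>\<eta> / 2\<close>, and along \<open>f(a \<cdot> b)\<close> the limit is known.\<close>
    then obtain a b where ab: "norm (f - dual_act lact ract a b f) \<le> \<eta> / (2 * K)"
      using dual_act_approx by metis
    have "\<forall>\<^sub>F p in F. dist (cdual_apply (dual_act lact ract a b f) (q (fst p) (snd p)))
        (cdual_apply f (q a b)) < \<eta> / 2"
      using \<eta> by (intro tendstoD[OF lim_act]) simp
    with contr have "\<forall>\<^sub>F p in F. dist (cdual_apply f (q (fst p) (snd p))) (cdual_apply f (q a b)) < \<eta>"
    proof eventually_elim
      case (elim p)
      let ?x = "q (fst p) (snd p)"
      have "cmod (cdual_apply (f - dual_act lact ract a b f) ?x)
          \<le> norm (f - dual_act lact ract a b f) * norm ?x"
        by (rule norm_cdual_apply_le)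
      also have "\<dots> \<le> \<eta> / (2 * K) * K"
        using ab elim(1) \<eta> K(1) by (intro mult_mono) simp_all
      finally have "dist (cdual_apply f ?x) (cdual_apply (dual_act lact ract a b f) ?x) \<le> \<eta> / 2"
        using K(1) by (simp add: minus_cdual.rep_eq dist_norm)
      then show ?case
        using elim(2) dist_triangle[of "cdual_apply f ?x" "cdual_apply f (q a b)"
            "cdual_apply (dual_act lact ract a b f) ?x"] by linarith
    qed
    then show "\<exists>c. \<forall>\<^sub>F p in F. dist (cdual_apply f (q (fst p) (snd p))) c < \<eta>" ..
  qed
  then obtain T where T: "\<And>f. ((\<lambda>p. cdual_apply f (q (fst p) (snd p))) \<longlongrightarrow> T f) F"
    by metis
  have T_add: "T (f + g) = T f + T g" for f g
    using tendsto_unique[OF F T[of "f + g"]] tendsto_add[OF T[of f] T[of g]]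
    by (simp add: plus_cdual.rep_eq)
  have T_scale: "T (c *\<^sub>C f) = c * T f" for c f
    using tendsto_unique[OF F T[of "c *\<^sub>C f"]] tendsto_mult[OF tendsto_const[of c] T[of f]]
    by (simp add: scaleC_cdual.rep_eq)
  have T_bound: "cmod (T f) \<le> K * norm f" for f
  proof (rule tendsto_upperbound[OF tendsto_norm[OF T] _ F])
    show "\<forall>\<^sub>F p in F. cmod (cdual_apply f (q (fst p) (snd p))) \<le> K * norm f"
      using contr
    proof eventually_elim
      case (elim p)
      then show ?case
        using norm_cdual_apply_le[of f "q (fst p) (snd p)"]
          mult_left_mono[of "norm (q (fst p) (snd p))" K "norm f"] by (simp add: mult.commute)
    qed
  qed
  define t where "t = CDual T"
  have t: "cdual_apply t = T"
    unfolding t_def by (rule CDual_inverse'[OF T_add T_scale T_bound])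
  have "bidual_embed (q a b) = bact a t b" for a b
  proof (rule cdual_eqI)
    fix f
    show "cdual_apply (bidual_embed (q a b)) f = cdual_apply (bact a t b) f"
      using tendsto_unique[OF F lim_act T] by (simp add: bidual_embed_apply bidual_act_apply t)
  qed
  then show thesis
    by (intro that[of t] in_BQ ext quasi_multiplier_of_unique)
qed

end

theorem mainTheorem1:
  fixes lact :: "'a::cstar_algebra \<Rightarrow> 'v::{complex_normed_vector, banach} \<Rightarrow> 'v"
    and ract :: "'v \<Rightarrow> 'b::cstar_algebra \<Rightarrow> 'v"
    and lip :: "'v \<Rightarrow> 'v \<Rightarrow> 'a"
    and rip :: "'v \<Rightarrow> 'v \<Rightarrow> 'b"
  assumes "hilbert_bimodule lact ract lip rip"
  shows "csubspace (bidual_quasi_multipliers lact ract)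
    \<and> (\<forall>t\<in>bidual_quasi_multipliers lact ract. \<forall>a b.
          bidual_embed (quasi_multiplier_of lact ract t a b) = bidual_act lact ract a t b)
    \<and> (\<forall>t\<in>bidual_quasi_multipliers lact ract.
          quasi_multiplier_of lact ract t \<in> quasi_multipliers lact ract)
    \<and> (\<forall>s\<in>bidual_quasi_multipliers lact ract. \<forall>t\<in>bidual_quasi_multipliers lact ract.
          quasi_multiplier_of lact ract (s + t)
            = (\<lambda>a b. quasi_multiplier_of lact ract s a b + quasi_multiplier_of lact ract t a b))
    \<and> (\<forall>c. \<forall>t\<in>bidual_quasi_multipliers lact ract.
          quasi_multiplier_of lact ract (c *\<^sub>C t)
            = (\<lambda>a b. c *\<^sub>C quasi_multiplier_of lact ract t a b))
    \<and> (\<forall>t\<in>bidual_quasi_multipliers lact ract.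
          qm_norm (quasi_multiplier_of lact ract t) = norm t)
    \<and> quasi_multiplier_of lact ract ` bidual_quasi_multipliers lact ract
        = quasi_multipliers lact ract"
proof -
  interpret hilbert_bimodule lact ract lip rip
    by fact
  have "qof ` BQ = quasi_multipliers lact ract"
    using quasi_multiplier_of_in by (auto elim: quasi_multiplier_of_surj)
  then show ?thesis
    by (simp add: csubspace_BQ bidual_embed_quasi_multiplier_of quasi_multiplier_of_in
        BQ_add BQ_scaleC fun_eq_iff qm_norm_quasi_multiplier_of)
qed

end
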